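(* Let $r\ge 3$ be an integer such that $r-1$ is a prime power. Then: (i) there exists an $[r,2r;3]$-bigraph of order $3r^2-3r+3$, whose defect is $\delta=\frac{3}{2}(r-1)$ if $r$ is odd and $\delta=\frac{3r}{2}-3$ if $r$ is even; (ii) there exists an $[r,2r;4]$-bigraph of order $3r^3-6r^2+6r$, whose defect is $\delta=3r^3-3r^2$; (iii) there exists an $[r,2r;6]$-bigraph of order $3r^5-12r^4+21r^3-18r^2+9r$, whose defect is $\delta=9r^5-24r^4+24r^3-9r^2$.
   Context: An $[a,b;d]$-bigraph is a connected bipartite graph with stable sets $V_1,V_2$, all vertices of $V_1$ of degree $a$, all vertices of $V_2$ of degree $b$, and diameter $d$. For degrees $2r>r$, the Moore bounds are: for odd diameter $3$, $M(2r,r;3)=3\left\lfloor\frac{1+r(2r-1)}{2}\right\rfloor$; for even diameter $2m$, $M(2r,r;2m)=3r\frac{[(2r-1)(r-1)]^m-1}{(2r-1)(r-1)-1}$ (so $M(2r,r;4)=6r^3-9r^2+6r$ and $M(2r,r;6)=12r^5-36r^4+45r^3-27r^2+9r$). The defect of an $[r,2r;d]$-bigraph is $M(2r,r;d)$ minus its order. *)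

theory Defs
  imports
    "Graph_Theory.Graph_Theory"
    "HOL-Number_Theory.Prime_Powers"
begin

text \<open>
  Undirected finite simple graphs are the \<open>graph\<close> locale of Graph\_Theory: finite loopfree
  digraphs without parallel arcs and with symmetric arc relation. Each edge is thus a pair of
  opposite arcs, and the degree of a vertex is its \<open>out_degree\<close>.
\<close>

text \<open>The distance of two vertices is the library's \<open>\<mu>\<close> (infimum of walk costs) with unit arc costs.\<close>

definition graph_dist :: "('a, 'b) pre_digraph \<Rightarrow> 'a \<Rightarrow> 'a \<Rightarrow> ereal" where
  "graph_dist G u v = wf_digraph.\<mu> G (\<lambda>_. 1) u v"

definition graph_diameter :: "('a, 'b) pre_digraph \<Rightarrow> ereal" where
  "graph_diameter G = (SUP u \<in> verts G. SUP v \<in> verts G. graph_dist G u v)"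

definition stable_set :: "('a, 'b) pre_digraph \<Rightarrow> 'a set \<Rightarrow> bool" where
  "stable_set G S \<longleftrightarrow> S \<subseteq> verts G \<and> (\<forall>u \<in> S. \<forall>v \<in> S. (u, v) \<notin> arcs_ends G)"

definition bigraph :: "nat \<Rightarrow> nat \<Rightarrow> nat \<Rightarrow> ('a, 'b) pre_digraph \<Rightarrow> bool" where
  "bigraph a b d G \<longleftrightarrow>
     graph G \<and> Digraph_Component.connected G \<and>
     (\<exists>V\<^sub>1 V\<^sub>2. verts G = V\<^sub>1 \<union> V\<^sub>2 \<and> V\<^sub>1 \<inter> V\<^sub>2 = {} \<and>
        stable_set G V\<^sub>1 \<and> stable_set G V\<^sub>2 \<and>
        (\<forall>v \<in> V\<^sub>1. out_degree G v = a) \<and>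
        (\<forall>v \<in> V\<^sub>2. out_degree G v = b)) \<and>
     graph_diameter G = ereal (real d)"

text \<open>The Moore bound \<open>M(2r, r; d)\<close>, specified only for \<open>d = 3\<close> and for even \<open>d = 2m\<close>.\<close>

definition moore_bound :: "nat \<Rightarrow> nat \<Rightarrow> real" where
  "moore_bound r d =
     (if d = 3 then 3 * real_of_int \<lfloor>(1 + real r * (2 * real r - 1)) / 2\<rfloor>
      else if even d then
        3 * real r * ((((2 * real r - 1) * (real r - 1)) ^ (d div 2) - 1)
          / ((2 * real r - 1) * (real r - 1) - 1))
      else undefined)"

definition defect :: "nat \<Rightarrow> nat \<Rightarrow> ('a, 'b) pre_digraph \<Rightarrow> real" where
  "defect r d G = moore_bound r d - real (card (verts G))"

end

theory Submission
  imports Defs "HOL-Algebra.Algebraic_Closure_Type" "Berlekamp_Zassenhaus.Finite_Field"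
    "HOL-Library.Product_Plus"
begin

text \<open>
  Let \<open>q = r - 1\<close>. For \<open>d = 3, 4, 6\<close> take the generalized \<open>d\<close>-gon of order \<open>(q, q)\<close> given by the
  projective plane, the symplectic quadrangle and the split Cayley hexagon. Its incidence graph is
  \<open>r\<close>-regular of diameter \<open>d\<close> with \<open>1 + q + \<dots> + q\<^bsup>d - 1\<^esup>\<close> points and as many lines. Replacing
  each point by two copies with the same neighbours doubles the degree of the lines and keeps the
  diameter. In the hexagon, points are null trace-zero octonions up to scalars, collinear if their
  product vanishes. A line meets the hyperplane orthogonal to a point \<open>x\<close> in some point \<open>w\<close>, and
  then \<open>x w\<close>, if not zero, is collinear with both \<open>x\<close> and \<open>w\<close>; so points and lines have distance
  at most five.
\<close>

hide_const (open) Divisibility.prime Polynomials.degree Polynomials.lead_coeff UnivPoly.monom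

section \<open>Distances in relations\<close>

definition dist_le :: "'v rel \<Rightarrow> nat \<Rightarrow> 'v \<Rightarrow> 'v \<Rightarrow> bool" where
  "dist_le E n u v \<longleftrightarrow> (\<exists>k\<le>n. (u, v) \<in> E ^^ k)"

definition has_diameter :: "'v set \<Rightarrow> 'v rel \<Rightarrow> nat \<Rightarrow> bool" where
  "has_diameter W E d \<longleftrightarrow> (\<forall>u\<in>W. \<forall>v\<in>W. dist_le E d u v) \<and>
     (\<exists>u\<in>W. \<exists>v\<in>W. \<forall>n. dist_le E n u v \<longrightarrow> d \<le> n)"

lemma has_diameterD: "has_diameter W E d \<Longrightarrow> u \<in> W \<Longrightarrow> v \<in> W \<Longrightarrow> dist_le E d u v"
  by (simp add: has_diameter_def)

lemma dist_le_if_relpow: "(u, v) \<in> E ^^ n \<Longrightarrow> dist_le E n u v"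
  unfolding dist_le_def by auto

lemma dist_le_mono: "dist_le E m u v \<Longrightarrow> m \<le> n \<Longrightarrow> dist_le E n u v"
  unfolding dist_le_def using order_trans by blast

lemma dist_le_trans:
  assumes "dist_le E m u v" "dist_le E n v w"
  shows "dist_le E (m + n) u w"
proof -
  obtain k k' where k: "k \<le> m" "(u, v) \<in> E ^^ k" and k': "k' \<le> n" "(v, w) \<in> E ^^ k'"
    using assms by (auto simp: dist_le_def)
  have "(u, w) \<in> E ^^ (k + k')"
    using k(2) k'(2) by (rule relpow_trans)
  with k(1) k'(1) show ?thesis
    unfolding dist_le_def by (intro exI[of _ "k + k'"]) simp
qed

lemma sym_relpow:
  assumes "sym E" "(u, v) \<in> E ^^ n"
  shows "(v, u) \<in> E ^^ n"
  using assms(2)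
proof (induction n arbitrary: v)
  case (Suc n)
  then obtain w where "(u, w) \<in> E ^^ n" "(w, v) \<in> E"
    by auto
  hence "(v, w) \<in> E" "(w, u) \<in> E ^^ n"
    using Suc.IH symD[OF assms(1)] by blast+
  thus ?case
    by (rule relpow_Suc_I2)
qed simp

lemma dist_le_sym: "sym E \<Longrightarrow> dist_le E n u v \<Longrightarrow> dist_le E n v u"
  by (auto simp: dist_le_def dest: sym_relpow)

lemma relpow_mono_if_refl:
  assumes "(u, u) \<in> E" "(u, v) \<in> E ^^ m" "m \<le> n"
  shows "(u, v) \<in> E ^^ n"
proof -
  have "(u, u) \<in> E ^^ k" for k
    using assms(1) by (induction k) auto
  hence "(u, v) \<in> E ^^ (n - m + m)"
    using assms(2) by (rule relpow_trans)
  thus ?thesis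
    using assms(3) by simp
qed

lemma relpow_Suc_inv_image:
  assumes "E \<subseteq> range f \<times> range f"
  shows "inv_image E f ^^ Suc n = inv_image (E ^^ Suc n) f"
proof (induction n)
  case (Suc n)
  have "inv_image (E ^^ Suc n) f O inv_image E f = inv_image (E ^^ Suc n O E) f"
    using assms by (fastforce simp: inv_image_def relcomp_unfold simp del: relpow.simps)
  thus ?case
    by (simp only: Suc.IH relpow.simps(2)[of "Suc n"])
qed simp

lemma dist_le_if_dist_le_inv_image:
  assumes "E \<subseteq> range f \<times> range f" "dist_le (inv_image E f) n x y"
  shows "dist_le E n (f x) (f y)"
proof -
  obtain k where k: "k \<le> n" "(x, y) \<in> inv_image E f ^^ k"
    using assms(2) by (auto simp: dist_le_def)
  have "(f x, f y) \<in> E ^^ k"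
  proof (cases k)
    case (Suc m)
    thus ?thesis
      using k(2) relpow_Suc_inv_image[OF assms(1), of m] by (simp del: relpow.simps)
  qed (use k(2) in simp)
  with k(1) show ?thesis
    by (auto simp: dist_le_def)
qed

text \<open>Vertices with the same image have a common neighbour: their distance grows from zero to two.\<close>

lemma dist_le_inv_image:
  assumes E: "sym E" "E \<subseteq> range f \<times> range f" and "f x \<in> Domain E" "n \<ge> 2" "dist_le E n (f x) (f y)"
  shows "dist_le (inv_image E f) n x y"
proof -
  obtain k where k: "k \<le> n" "(f x, f y) \<in> E ^^ k"
    using assms(5) by (auto simp: dist_le_def)
  obtain m where "Suc m \<le> n" "(f x, f y) \<in> E ^^ Suc m"
  proof (cases k)
    case 0
    obtain u where u: "(f x, u) \<in> E"
      using assms(3) by auto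
    hence "(f x, f y) \<in> E ^^ Suc 1"
      using 0 k(2) symD[OF E(1) u] by auto
    thus ?thesis
      using that[of 1] \<open>n \<ge> 2\<close> by simp
  qed (use k that in simp)
  hence "(x, y) \<in> inv_image E f ^^ Suc m"
    unfolding relpow_Suc_inv_image[OF E(2)] by (simp del: relpow.simps)
  with \<open>Suc m \<le> n\<close> show ?thesis
    unfolding dist_le_def by blast
qed

lemma has_diameter_inv_image:
  assumes diameter: "has_diameter W E d" and "d \<ge> 2"
    and E: "sym E" "E \<subseteq> W \<times> W" "W \<subseteq> Domain E" and f: "W \<subseteq> range f"
  shows "has_diameter (f -` W) (inv_image E f) d"
proof -
  have E_range: "E \<subseteq> range f \<times> range f"
    using E(2) f by auto
  have "dist_le (inv_image E f) d x y" if "f x \<in> W" "f y \<in> W" for x y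
    using E(3) that(1)
    by (intro dist_le_inv_image[OF E(1) E_range] \<open>d \<ge> 2\<close> has_diameterD[OF diameter that]) auto
  moreover obtain u v where uv: "u \<in> W" "v \<in> W" "\<And>n. dist_le E n u v \<Longrightarrow> d \<le> n"
    using diameter by (auto simp: has_diameter_def)
  moreover obtain x y where "u = f x" "v = f y"
    using uv(1,2) f by blast
  ultimately show ?thesis
    using dist_le_if_dist_le_inv_image[OF E_range] unfolding has_diameter_def by blast
qed

lemma relpow_map_prod:
  assumes "inj_on f W" "E \<subseteq> W \<times> W" "u \<in> W" "v \<in> W"
  shows "(f u, f v) \<in> (map_prod f f ` E) ^^ n \<longleftrightarrow> (u, v) \<in> E ^^ n"
  using \<open>v \<in> W\<close>
proof (induction n arbitrary: v)
  case 0
  thus ?case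
    using assms(1,3) by (auto dest: inj_onD)
next
  case (Suc n)
  have "(f u, f v) \<in> (map_prod f f ` E) ^^ Suc n \<longleftrightarrow>
      (\<exists>w. (f u, f w) \<in> (map_prod f f ` E) ^^ n \<and> (w, v) \<in> E)"
    using assms(1,2) Suc.prems by (fastforce dest: inj_onD)
  also have "\<dots> \<longleftrightarrow> (\<exists>w. (u, w) \<in> E ^^ n \<and> (w, v) \<in> E)"
    using Suc.IH assms(2) by blast
  finally show ?case
    by auto
qed

lemma has_diameter_map_prod:
  assumes "inj_on f W" "E \<subseteq> W \<times> W" "has_diameter W E d"
  shows "has_diameter (f ` W) (map_prod f f ` E) d"
  using assms(3) unfolding has_diameter_def dist_le_def
  by (simp add: relpow_map_prod[OF assms(1,2)] cong: bex_cong)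

section \<open>Bigraphs from symmetric relations\<close>

definition biregular :: "'v set \<Rightarrow> 'v set \<Rightarrow> 'v rel \<Rightarrow> nat \<Rightarrow> nat \<Rightarrow> bool" where
  "biregular V\<^sub>1 V\<^sub>2 E a b \<longleftrightarrow> V\<^sub>1 \<inter> V\<^sub>2 = {} \<and> E \<subseteq> V\<^sub>1 \<times> V\<^sub>2 \<union> V\<^sub>2 \<times> V\<^sub>1 \<and> sym E \<and>
     (\<forall>u\<in>V\<^sub>1. card (E `` {u}) = a) \<and> (\<forall>u\<in>V\<^sub>2. card (E `` {u}) = b)"

definition graph_of :: "'v set \<Rightarrow> 'v rel \<Rightarrow> ('v, 'v \<times> 'v) pre_digraph" where
  "graph_of W E = \<lparr>verts = W, arcs = E, tail = fst, head = snd\<rparr>"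

lemma graph_of_simps [simp]:
  "verts (graph_of W E) = W" "arcs (graph_of W E) = E"
  "tail (graph_of W E) = fst" "head (graph_of W E) = snd"
  by (simp_all add: graph_of_def)

lemma arcs_ends_graph_of [simp]: "arcs_ends (graph_of W E) = E"
  by (auto simp: arcs_ends_def arc_to_ends_def)

lemma graph_graph_of:
  assumes "finite W" "E \<subseteq> W \<times> W" "sym E" "irrefl E"
  shows "graph (graph_of W E)"
proof -
  have "finite E"
    using assms finite_subset by blast
  thus ?thesis
    using assms
    by unfold_locales (auto simp: arc_to_ends_def irrefl_def symmetric_def)
qed

lemma out_degree_graph_of: "out_degree (graph_of W E) u = card (E `` {u})"
proof -
  have "out_arcs (graph_of W E) u = Pair u ` (E `` {u})"
    by (auto simp: out_arcs_def)
  thus ?thesis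
    by (simp add: out_degree_def card_image inj_on_def)
qed

context
  fixes W :: "'v set" and E :: "'v rel"
  assumes E: "E \<subseteq> W \<times> W"
begin

interpretation wf_digraph "graph_of W E"
  using E by unfold_locales auto

lemma ex_awalk_iff_relpow:
  "u \<in> W \<Longrightarrow> (\<exists>p. pre_digraph.awalk (graph_of W E) u p v \<and> length p = n) \<longleftrightarrow> (u, v) \<in> E ^^ n"
proof (induction n arbitrary: u)
  case 0
  thus ?case by (auto simp: awalk_def)
next
  case (Suc n)
  have "(\<exists>p. awalk u p v \<and> length p = Suc n) \<longleftrightarrow>
      (\<exists>w. (u, w) \<in> E \<and> (\<exists>p. awalk w p v \<and> length p = n))"
  proof safe
    fix p assume p: "awalk u p v" "length p = Suc n"
    then obtain e p' where "p = e # p'"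
      by (cases p) auto
    with p have "(u, snd e) \<in> E" "awalk (snd e) p' v" "length p' = n"
      using E by (auto simp: awalk_def)
    thus "\<exists>w. (u, w) \<in> E \<and> (\<exists>p. awalk w p v \<and> length p = n)"
      by blast
  next
    fix w p assume "(u, w) \<in> E" "awalk w p v" "n = length p"
    with Suc.prems have "awalk u ((u, w) # p) v"
      by (simp add: awalk_def)
    thus "\<exists>p'. awalk u p' v \<and> length p' = Suc (length p)"
      by (metis length_Cons)
  qed
  also have "\<dots> \<longleftrightarrow> (\<exists>w. (u, w) \<in> E \<and> (w, v) \<in> E ^^ n)"
    using E Suc.IH by (metis (no_types, lifting) mem_Sigma_iff subsetD)
  also have "\<dots> \<longleftrightarrow> (u, v) \<in> E ^^ Suc n"
    by (metis relpow_Suc_D2 relpow_Suc_I2)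
  finally show ?case .
qed

lemma graph_dist_graph_of:
  assumes "u \<in> W"
  shows "graph_dist (graph_of W E) u v = (INF n\<in>{n. (u, v) \<in> E ^^ n}. ereal (real n))"
proof -
  have "awalk_cost (\<lambda>_. 1) p = real (length p)" for p
    by (simp add: awalk_cost_def sum_list_triv)
  moreover have "{n. (u, v) \<in> E ^^ n} = length ` {p. awalk u p v}"
    by (auto simp flip: ex_awalk_iff_relpow[OF assms])
  ultimately show ?thesis
    by (simp add: graph_dist_def \<mu>_def image_image)
qed

lemma graph_diameter_graph_of:
  assumes "has_diameter W E d"
  shows "graph_diameter (graph_of W E) = ereal (real d)"
proof (rule antisym)
  have "graph_dist (graph_of W E) u v \<le> ereal (real d)" if "u \<in> W" "v \<in> W" for u v
    using has_diameterD[OF assms that] unfolding dist_le_def graph_dist_graph_of[OF that(1)]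
    by (auto intro: INF_lower2)
  thus "graph_diameter (graph_of W E) \<le> ereal (real d)"
    by (auto simp: graph_diameter_def intro!: SUP_least)
  obtain u v where uv: "u \<in> W" "v \<in> W" "\<And>n. dist_le E n u v \<Longrightarrow> d \<le> n"
    using assms by (auto simp: has_diameter_def)
  have "d \<le> n" if "(u, v) \<in> E ^^ n" for n
    using uv(3) that by (auto simp: dist_le_def)
  hence "ereal (real d) \<le> graph_dist (graph_of W E) u v"
    by (auto simp: graph_dist_graph_of[OF uv(1)] intro: INF_greatest)
  also have "\<dots> \<le> (SUP v\<in>W. graph_dist (graph_of W E) u v)"
    using uv(2) by (rule SUP_upper)
  also have "\<dots> \<le> graph_diameter (graph_of W E)"
    unfolding graph_diameter_def graph_of_simps using uv(1) by (rule SUP_upper)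
  finally show "ereal (real d) \<le> graph_diameter (graph_of W E)" .
qed

lemma connected_graph_of:
  assumes "has_diameter W E d"
  shows "Digraph_Component.connected (graph_of W E)"
proof -
  have "u \<rightarrow>\<^sup>*\<^bsub>graph_of W E\<^esub> v" if uv: "u \<in> W" "v \<in> W" for u v
  proof -
    obtain n where "(u, v) \<in> E ^^ n"
      using has_diameterD[OF assms uv] by (auto simp: dist_le_def)
    thus ?thesis
      using ex_awalk_iff_relpow[OF uv(1)] by (metis reachable_awalk)
  qed
  moreover have "W \<noteq> {}"
    using assms by (auto simp: has_diameter_def)
  ultimately show ?thesis
    unfolding Digraph_Component.connected_def
    by (intro strongly_connectedI) (auto intro: reachable_mk_symmetricI)
qed

end

lemma bigraph_graph_of:
  assumes "finite V\<^sub>1" "finite V\<^sub>2" and biregular: "biregular V\<^sub>1 V\<^sub>2 E a b"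
    and diameter: "has_diameter (V\<^sub>1 \<union> V\<^sub>2) E d"
  shows "bigraph a b d (graph_of (V\<^sub>1 \<union> V\<^sub>2) E)"
  unfolding bigraph_def
proof (intro conjI exI)
  have E: "E \<subseteq> (V\<^sub>1 \<union> V\<^sub>2) \<times> (V\<^sub>1 \<union> V\<^sub>2)" "V\<^sub>1 \<inter> V\<^sub>2 = {}" "E \<subseteq> V\<^sub>1 \<times> V\<^sub>2 \<union> V\<^sub>2 \<times> V\<^sub>1"
    using biregular by (auto simp: biregular_def)
  show "graph (graph_of (V\<^sub>1 \<union> V\<^sub>2) E)"
    using assms(1,2) biregular E by (intro graph_graph_of) (auto simp: biregular_def irrefl_def)
  show "Digraph_Component.connected (graph_of (V\<^sub>1 \<union> V\<^sub>2) E)"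
    using E(1) diameter by (rule connected_graph_of)
  show "graph_diameter (graph_of (V\<^sub>1 \<union> V\<^sub>2) E) = ereal (real d)"
    using E(1) diameter by (rule graph_diameter_graph_of)
  show "stable_set (graph_of (V\<^sub>1 \<union> V\<^sub>2) E) V\<^sub>1" "stable_set (graph_of (V\<^sub>1 \<union> V\<^sub>2) E) V\<^sub>2"
    using E(2,3) by (auto simp: stable_set_def)
qed (use biregular in \<open>auto simp: biregular_def out_degree_graph_of\<close>)

lemma biregular_map_prod:
  assumes "inj_on f (V\<^sub>1 \<union> V\<^sub>2)" "biregular V\<^sub>1 V\<^sub>2 E a b"
  shows "biregular (f ` V\<^sub>1) (f ` V\<^sub>2) (map_prod f f ` E) a b"
proof -
  have E: "V\<^sub>1 \<inter> V\<^sub>2 = {}" "E \<subseteq> V\<^sub>1 \<times> V\<^sub>2 \<union> V\<^sub>2 \<times> V\<^sub>1" "sym E"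
    using assms(2) by (auto simp: biregular_def)
  have "card ((map_prod f f ` E) `` {f u}) = card (E `` {u})" if "u \<in> V\<^sub>1 \<union> V\<^sub>2" for u
  proof -
    have "(map_prod f f ` E) `` {f u} = f ` (E `` {u})"
      using that E(2) assms(1) by (fastforce dest: inj_onD)
    moreover have "E `` {u} \<subseteq> V\<^sub>1 \<union> V\<^sub>2"
      using E(2) by auto
    ultimately show ?thesis
      using assms(1) by (metis card_image inj_on_subset)
  qed
  moreover have "f ` V\<^sub>1 \<inter> f ` V\<^sub>2 = {}"
    using assms(1) E(1) by (auto dest: inj_onD)
  moreover have "map_prod f f ` E \<subseteq> f ` V\<^sub>1 \<times> f ` V\<^sub>2 \<union> f ` V\<^sub>2 \<times> f ` V\<^sub>1" "sym (map_prod f f ` E)"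
    using E(2,3) by (auto simp: sym_def)
  ultimately show ?thesis
    using assms(2) by (simp add: biregular_def)
qed

definition ex_bigraph :: "nat \<Rightarrow> nat \<Rightarrow> nat \<Rightarrow> nat \<Rightarrow> bool" where
  "ex_bigraph a b d n \<longleftrightarrow> (\<exists>G :: (nat, nat \<times> nat) pre_digraph. bigraph a b d G \<and> card (verts G) = n)"

lemma ex_bigraph_if_biregular:
  assumes fin: "finite V\<^sub>1" "finite V\<^sub>2" and biregular: "biregular V\<^sub>1 V\<^sub>2 E a b"
    and diameter: "has_diameter (V\<^sub>1 \<union> V\<^sub>2) E d"
  shows "ex_bigraph a b d (card V\<^sub>1 + card V\<^sub>2)"
proof -
  obtain f :: "_ \<Rightarrow> nat" where f: "inj_on f (V\<^sub>1 \<union> V\<^sub>2)"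
    using fin finite_imp_inj_to_nat_seg[of "V\<^sub>1 \<union> V\<^sub>2"] by auto
  have "E \<subseteq> (V\<^sub>1 \<union> V\<^sub>2) \<times> (V\<^sub>1 \<union> V\<^sub>2)" "V\<^sub>1 \<inter> V\<^sub>2 = {}"
    using biregular by (auto simp: biregular_def)
  hence "has_diameter (f ` V\<^sub>1 \<union> f ` V\<^sub>2) (map_prod f f ` E) d"
    "card (f ` V\<^sub>1 \<union> f ` V\<^sub>2) = card V\<^sub>1 + card V\<^sub>2"
    using has_diameter_map_prod[OF f _ diameter] card_image[OF f] fin
    by (simp_all add: image_Un card_Un_disjoint)
  moreover have "biregular (f ` V\<^sub>1) (f ` V\<^sub>2) (map_prod f f ` E) a b"
    using f biregular by (rule biregular_map_prod)
  ultimately show ?thesis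
    using fin bigraph_graph_of unfolding ex_bigraph_def by (metis finite_imageI graph_of_simps(1))
qed

section \<open>Incidence structures\<close>

definition incidence_graph :: "('p \<times> 'l) set \<Rightarrow> ('p + 'l) rel" where
  "incidence_graph I = (\<lambda>(p, l). (Inl p, Inr l)) ` I \<union> (\<lambda>(p, l). (Inr l, Inl p)) ` I"

definition collinear :: "('p \<times> 'l) set \<Rightarrow> 'p rel" where
  "collinear I = I O I\<inverse>"

definition regular_incidence :: "'p set \<Rightarrow> 'l set \<Rightarrow> ('p \<times> 'l) set \<Rightarrow> nat \<Rightarrow> nat \<Rightarrow> bool" where
  "regular_incidence P L I a b \<longleftrightarrow> I \<subseteq> P \<times> L \<and>
     (\<forall>p\<in>P. card (I `` {p}) = a) \<and> (\<forall>l\<in>L. card (I\<inverse> `` {l}) = b)"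

lemma incidence_graph_simps [simp]:
  "(Inl p, Inr l) \<in> incidence_graph I \<longleftrightarrow> (p, l) \<in> I"
  "(Inr l, Inl p) \<in> incidence_graph I \<longleftrightarrow> (p, l) \<in> I"
  "(Inl p, Inl p') \<notin> incidence_graph I" "(Inr l, Inr l') \<notin> incidence_graph I"
  by (auto simp: incidence_graph_def)

lemma sym_incidence_graph: "sym (incidence_graph I)"
  by (auto simp: incidence_graph_def sym_def)

lemma regular_incidence_imp_biregular:
  assumes "regular_incidence P L I a b"
  shows "biregular (Inl ` P) (Inr ` L) (incidence_graph I) a b"
proof -
  have "incidence_graph I `` {Inl p} = Inr ` (I `` {p})"
    "incidence_graph I `` {Inr l} = Inl ` (I\<inverse> `` {l})" for p l
    by (auto simp: incidence_graph_def)
  thus ?thesis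
    using assms sym_incidence_graph[of I]
    by (auto simp: biregular_def regular_incidence_def incidence_graph_def card_image)
qed

lemma regular_incidence_imp_Domain_Range:
  assumes "regular_incidence P L I a b" "a > 0" "b > 0"
  shows "P \<subseteq> Domain I" "L \<subseteq> Range I"
proof -
  have "I `` {p} \<noteq> {}" if "p \<in> P" for p
    using assms that by (auto simp: regular_incidence_def)
  thus "P \<subseteq> Domain I"
    by auto
  have "I\<inverse> `` {l} \<noteq> {}" if "l \<in> L" for l
    using assms that by (auto simp: regular_incidence_def)
  thus "L \<subseteq> Range I"
    by auto
qed

lemma card_incidences:
  assumes "regular_incidence P L I a b" "finite P" "finite L"
  shows "card P * a = card L * b"
proof -
  have fin: "finite I"
    using assms by (auto simp: regular_incidence_def intro: finite_subset)
  have "card I = card (Sigma P (\<lambda>p. I `` {p}))"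
    using assms(1) by (intro arg_cong[of _ _ card]) (auto simp: regular_incidence_def)
  also have "\<dots> = (\<Sum>p\<in>P. card (I `` {p}))"
    using fin assms(2) by (intro card_SigmaI) auto
  finally have points: "card I = card P * a"
    using assms(1) by (simp add: regular_incidence_def)
  have "card (I\<inverse>) = card (Sigma L (\<lambda>l. I\<inverse> `` {l}))"
    using assms(1) by (intro arg_cong[of _ _ card]) (auto simp: regular_incidence_def)
  also have "\<dots> = (\<Sum>l\<in>L. card (I\<inverse> `` {l}))"
    using fin assms(3) by (intro card_SigmaI) auto
  finally have "card (I\<inverse>) = card L * b"
    using assms(1) by (simp add: regular_incidence_def)
  with points show ?thesis
    by simp
qed

lemma relpow_incidence_graph_points:
  "(Inl p, Inl p') \<in> incidence_graph I ^^ (2 * n) \<longleftrightarrow> (p, p') \<in> collinear I ^^ n"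
proof (induction n arbitrary: p')
  case (Suc n)
  have two_steps: "(w, Inl p') \<in> incidence_graph I O incidence_graph I \<longleftrightarrow>
      (\<exists>q. w = Inl q \<and> (q, p') \<in> collinear I)" for w
    by (auto simp: incidence_graph_def collinear_def)
  have "incidence_graph I ^^ (2 * Suc n) =
      incidence_graph I ^^ (2 * n) O (incidence_graph I O incidence_graph I)"
    by (simp add: O_assoc)
  hence "(Inl p, Inl p') \<in> incidence_graph I ^^ (2 * Suc n) \<longleftrightarrow>
      (\<exists>w. (Inl p, w) \<in> incidence_graph I ^^ (2 * n) \<and>
        (w, Inl p') \<in> incidence_graph I O incidence_graph I)"
    by (simp only: relcomp_unfold mem_Collect_eq prod.case)
  also have "\<dots> \<longleftrightarrow> (\<exists>q. (p, q) \<in> collinear I ^^ n \<and> (q, p') \<in> collinear I)"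
    unfolding two_steps using Suc.IH by blast
  finally show ?case
    by (simp only: relcomp_unfold relpow.simps mem_Collect_eq prod.case)
qed simp

lemma relpow_incidence_graph_point_line:
  "(Inl p, Inr l) \<in> incidence_graph I ^^ Suc (2 * n) \<longleftrightarrow> (p, l) \<in> collinear I ^^ n O I"
proof -
  have "(Inl p, Inr l) \<in> incidence_graph I ^^ Suc (2 * n) \<longleftrightarrow>
      (\<exists>w. (Inl p, w) \<in> incidence_graph I ^^ (2 * n) \<and> (w, Inr l) \<in> incidence_graph I)"
    by (simp only: relcomp_unfold relpow.simps mem_Collect_eq prod.case)
  also have "\<dots> \<longleftrightarrow> (\<exists>q. (Inl p, Inl q) \<in> incidence_graph I ^^ (2 * n) \<and> (q, l) \<in> I)"
    by (metis incidence_graph_simps(1,4) sum.exhaust)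
  finally show ?thesis
    by (auto simp: relpow_incidence_graph_points)
qed

lemma relpow_incidence_graph_isl_iff:
  "(u, v) \<in> incidence_graph I ^^ n \<Longrightarrow> isl u = isl v \<longleftrightarrow> even n"
proof (induction n arbitrary: v)
  case (Suc n)
  then obtain w where "(u, w) \<in> incidence_graph I ^^ n" "(w, v) \<in> incidence_graph I"
    by auto
  thus ?case
    using Suc.IH[of w] by (cases w; cases v) auto
qed simp

lemma dist_le_incidence_graph_Suc:
  assumes I: "I \<subseteq> P \<times> L" and Dom: "P \<subseteq> Domain I" and Ran: "L \<subseteq> Range I"
    and near: "\<And>p l. p \<in> P \<Longrightarrow> l \<in> L \<Longrightarrow> dist_le (incidence_graph I) n (Inl p) (Inr l)"
    and uv: "u \<in> P <+> L" "v \<in> P <+> L"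
  shows "dist_le (incidence_graph I) (Suc n) u v"
proof -
  note sym = dist_le_sym[OF sym_incidence_graph]
  have edge: "dist_le (incidence_graph I) 1 (Inl p) (Inr l)" if "(p, l) \<in> I" for p l
    using that by (intro dist_le_if_relpow) simp
  have point: "dist_le (incidence_graph I) (Suc n) (Inl p) v" if "p \<in> P" "v \<in> P <+> L" for p v
    using that(2)
  proof (elim PlusE)
    fix p' assume v: "v = Inl p'" "p' \<in> P"
    then obtain l where "(p', l) \<in> I"
      using Dom by auto
    thus ?thesis
      using dist_le_trans[OF near[OF that(1)] sym[OF edge]] I v by auto
  next
    fix l assume v: "v = Inr l" "l \<in> L"
    thus ?thesis
      using dist_le_mono[OF near[OF that(1)]] by simp
  qed
  show ?thesis
    using uv(1)
  proof (elim PlusE)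
    fix l assume u: "u = Inr l" "l \<in> L"
    show ?thesis
      using uv(2)
    proof (elim PlusE)
      fix l' assume v: "v = Inr l'" "l' \<in> L"
      then obtain p where "(p, l') \<in> I"
        using Ran by auto
      thus ?thesis
        using dist_le_trans[OF sym[OF near[OF _ u(2)]] edge] I u v by auto
    qed (use u uv(1) point sym in blast)
  qed (use uv(2) point in blast)
qed

lemma has_diameter_incidence_graph_even:
  assumes I: "I \<subseteq> P \<times> L" "P \<subseteq> Domain I" "L \<subseteq> Range I"
    and near: "\<And>p l. p \<in> P \<Longrightarrow> l \<in> L \<Longrightarrow> (p, l) \<in> collinear I ^^ n O I"
    and far: "p \<in> P" "p' \<in> P" "(p, p') \<notin> collinear I ^^ n"
  shows "has_diameter (P <+> L) (incidence_graph I) (2 * n + 2)"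
  unfolding has_diameter_def
proof (intro conjI ballI bexI allI impI)
  show "dist_le (incidence_graph I) (2 * n + 2) u v" if "u \<in> P <+> L" "v \<in> P <+> L" for u v
  proof -
    have "dist_le (incidence_graph I) (Suc (2 * n)) (Inl p) (Inr l)" if "p \<in> P" "l \<in> L" for p l
      using near[OF that]
      by (intro dist_le_if_relpow) (simp only: relpow_incidence_graph_point_line)
    from dist_le_incidence_graph_Suc[OF I this that] show ?thesis
      by simp
  qed
  fix k assume "dist_le (incidence_graph I) k (Inl p) (Inl p')"
  then obtain j where j: "j \<le> k" "(Inl p, Inl p') \<in> incidence_graph I ^^ j"
    by (auto simp: dist_le_def)
  then obtain i where i: "j = 2 * i"
    using relpow_incidence_graph_isl_iff by fastforce
  have "(p, p') \<in> collinear I ^^ i"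
    using j(2) by (simp only: i relpow_incidence_graph_points)
  moreover have "(p, p) \<in> collinear I"
    using I(2) far(1) by (auto simp: collinear_def)
  ultimately have "n < i"
    using relpow_mono_if_refl far(3) by (metis not_le)
  thus "2 * n + 2 \<le> k"
    using i j(1) by simp
qed (use far in auto)

lemma dist_le_2_if_concurrent:
  assumes "(l, l') \<in> collinear (I\<inverse>)"
  shows "dist_le (incidence_graph I) 2 (Inr l) (Inr l')"
proof -
  obtain p where "(p, l) \<in> I" "(p, l') \<in> I"
    using assms by (auto simp: collinear_def)
  hence "(Inr l, Inr l') \<in> incidence_graph I O incidence_graph I"
    by (intro relcompI[of _ "Inl p"]) simp_all
  hence "(Inr l, Inr l') \<in> incidence_graph I ^^ 2"
    by (simp add: numeral_2_eq_2)
  thus ?thesis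
    by (rule dist_le_if_relpow)
qed

lemma has_diameter_incidence_graph_3:
  assumes points: "P \<times> P \<subseteq> collinear I" and lines: "L \<times> L \<subseteq> collinear (I\<inverse>)"
    and far: "p \<in> P" "l \<in> L" "(p, l) \<notin> I" and I: "I \<subseteq> P \<times> L"
  shows "has_diameter (P <+> L) (incidence_graph I) 3"
  unfolding has_diameter_def
proof (intro conjI ballI bexI allI impI)
  have point_line: "dist_le (incidence_graph I) 3 (Inl p) (Inr l)" if "p \<in> P" "l \<in> L" for p l
  proof -
    obtain p' where "(p', l) \<in> I"
      using lines \<open>l \<in> L\<close> by (auto simp: collinear_def)
    hence "(p, l) \<in> collinear I ^^ 1 O I"
      using points I that(1) by auto
    hence "(Inl p, Inr l) \<in> incidence_graph I ^^ 3"
      using relpow_incidence_graph_point_line[of p l 1 I] by (simp add: numeral_3_eq_3)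
    thus ?thesis
      by (rule dist_le_if_relpow)
  qed
  have point_point: "dist_le (incidence_graph I) 2 (Inl p) (Inl p')" if "p \<in> P" "p' \<in> P" for p p'
    using points that relpow_incidence_graph_points[of p p' 1 I] by (intro dist_le_if_relpow) auto
  have line_line: "dist_le (incidence_graph I) 2 (Inr l) (Inr l')" if "l \<in> L" "l' \<in> L" for l l'
    using lines that by (intro dist_le_2_if_concurrent) auto
  show "dist_le (incidence_graph I) 3 u v" if "u \<in> P <+> L" "v \<in> P <+> L" for u v
    using that
    by (elim PlusE) (auto intro: point_line dist_le_sym[OF sym_incidence_graph point_line]
      dist_le_mono[OF point_point] dist_le_mono[OF line_line])
  fix k assume "dist_le (incidence_graph I) k (Inl p) (Inr l)"
  then obtain j where j: "j \<le> k" "(Inl p, Inr l) \<in> incidence_graph I ^^ j"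
    by (auto simp: dist_le_def)
  hence "odd j"
    using relpow_incidence_graph_isl_iff by fastforce
  moreover have "j \<noteq> 1"
    using j(2) far(3) by auto
  ultimately show "3 \<le> k"
    using j(1) by presburger
qed (use far in auto)

definition replicate_points :: "('p \<times> 'l) set \<Rightarrow> (('p \<times> 'c) \<times> 'l) set" where
  "replicate_points I = {((p, c), l) |p c l. (p, l) \<in> I}"

lemma regular_incidence_replicate_points:
  assumes "regular_incidence P L I a b"
  shows "regular_incidence (P \<times> (UNIV :: 'c set)) L (replicate_points I) a (b * CARD('c))"
proof -
  have "replicate_points I `` {(p, c)} = I `` {p}"
    "(replicate_points I)\<inverse> `` {l} = I\<inverse> `` {l} \<times> (UNIV :: 'c set)" for p l and c :: 'c
    by (auto simp: replicate_points_def)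
  moreover have "replicate_points I \<subseteq> (P \<times> (UNIV :: 'c set)) \<times> L"
    using assms by (auto simp: regular_incidence_def replicate_points_def)
  ultimately show ?thesis
    using assms by (simp add: regular_incidence_def card_cartesian_product)
qed

lemma incidence_graph_replicate_points:
  "incidence_graph (replicate_points I) = inv_image (incidence_graph I) (map_sum fst id)"
  unfolding set_eq_iff split_paired_All
proof (intro allI)
  fix u v :: "'a \<times> 'b + 'c"
  show "(u, v) \<in> incidence_graph (replicate_points I) \<longleftrightarrow>
      (u, v) \<in> inv_image (incidence_graph I) (map_sum fst id)"
    by (cases u; cases v) (auto simp: replicate_points_def)
qed

lemma ex_bigraph_replicate_points:
  fixes P :: "'p set" and L :: "'l set"
  assumes fin: "finite P" "finite L" and reg: "regular_incidence P L I a b" "a > 0" "b > 0"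
    and diameter: "has_diameter (P <+> L) (incidence_graph I) d" "d \<ge> 2"
  shows "ex_bigraph a (b * CARD('c :: finite)) d (card P * CARD('c) + card L)"
proof -
  define V\<^sub>1 V\<^sub>2 :: "('p \<times> 'c + 'l) set" where "V\<^sub>1 = Inl ` (P \<times> UNIV)" and "V\<^sub>2 = Inr ` L"
  define E where "E = incidence_graph (replicate_points I :: (('p \<times> 'c) \<times> 'l) set)"
  have "has_diameter (map_sum fst id -` (P <+> L)) E d"
    unfolding E_def incidence_graph_replicate_points
  proof (rule has_diameter_inv_image[OF diameter sym_incidence_graph])
    show "incidence_graph I \<subseteq> (P <+> L) \<times> (P <+> L)"
      using reg(1) by (auto simp: incidence_graph_def regular_incidence_def)
    have "P \<subseteq> Domain I" "L \<subseteq> Range I"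
      using regular_incidence_imp_Domain_Range[OF reg] by auto
    thus "P <+> L \<subseteq> Domain (incidence_graph I)"
      by (fastforce simp: incidence_graph_def)
    show "P <+> L \<subseteq> range (map_sum fst id)"
    proof
      fix u assume "u \<in> P <+> L"
      show "u \<in> range (map_sum fst id)"
        by (rule range_eqI[of _ _ "map_sum (\<lambda>p. (p, undefined)) id u"])
          (simp add: sum.map_comp o_def sum.map_ident)
    qed
  qed
  moreover have "map_sum fst id -` (P <+> L) = V\<^sub>1 \<union> V\<^sub>2"
    by (auto simp: V\<^sub>1_def V\<^sub>2_def map_sum_def split: sum.splits)
  moreover have "biregular V\<^sub>1 V\<^sub>2 E a (b * CARD('c))"
    unfolding E_def V\<^sub>1_def V\<^sub>2_def
    by (intro regular_incidence_imp_biregular regular_incidence_replicate_points reg(1))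
  moreover have "finite V\<^sub>1" "finite V\<^sub>2"
    using fin by (simp_all add: V\<^sub>1_def V\<^sub>2_def)
  ultimately have "ex_bigraph a (b * CARD('c)) d (card V\<^sub>1 + card V\<^sub>2)"
    by (intro ex_bigraph_if_biregular) simp_all
  thus ?thesis
    by (simp add: V\<^sub>1_def V\<^sub>2_def card_image card_cartesian_product)
qed

section \<open>Vector spaces over finite fields\<close>

lemma CARD_field_gt_1: "CARD('a :: {field, finite}) > 1"
proof -
  have "card {0, 1 :: 'a} \<le> CARD('a)"
    by (intro card_mono) auto
  thus ?thesis
    by simp
qed

lemma eq_geometric_sum:
  fixes N q :: nat
  assumes "q > 1" "q ^ k = N * (q - 1) + 1"
  shows "N = (\<Sum>i<k. q ^ i)"
proof -
  have "int N * (int q - 1) = int q ^ k - 1"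
    using assms by (simp add: of_nat_diff flip: of_nat_power)
  also have "\<dots> = (\<Sum>i<k. int q ^ i) * (int q - 1)"
    by (simp add: power_diff_1_eq)
  finally have "int N = int (\<Sum>i<k. q ^ i)"
    using assms(1) by simp
  thus ?thesis
    by (simp only: of_nat_eq_iff)
qed

lemma card_UNIV_eq_card_range_mult_card_kernel:
  fixes f :: "'v :: {ab_group_add, finite} \<Rightarrow> 'w :: ab_group_add"
  assumes diff: "\<And>x y. f (x - y) = f x - f y"
  shows "CARD('v) = card (range f) * card {x. f x = 0}"
proof -
  have "card {x. f x = y} = card {x. f x = 0}" if y: "y \<in> range f" for y
  proof -
    obtain z where z: "y = f z"
      using y by blast
    have "f (x + z) = f x + f z" for x
      using diff[of "x + z" z] by (metis add_diff_cancel_right' diff_add_cancel)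
    hence "bij_betw (\<lambda>x. x - z) {x. f x = y} {x. f x = 0}"
      by (intro bij_betw_byWitness[where f' = "\<lambda>x. x + z"]) (auto simp: diff z)
    thus ?thesis
      by (rule bij_betw_same_card)
  qed
  moreover have "CARD('v) = (\<Sum>y\<in>range f. card {x. f x = y})"
    using sum.image_gen[of UNIV "\<lambda>_. 1 :: nat" f] by simp
  ultimately show ?thesis
    by simp
qed

locale finite_vector_space = vector_space scale
  for scale :: "'a :: {field, finite} \<Rightarrow> 'v :: {ab_group_add, finite} \<Rightarrow> 'v" (infixr "*s" 75)
begin

sublocale finite_dimensional_vector_space scale "extend_basis {}"
  by unfold_locales (simp_all add: independent_extend_basis independent_empty)

lemma card_span_insert:
  assumes "x \<notin> span B"
  shows "card (span (insert x B)) = CARD('a) * card (span B)"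
proof -
  let ?f = "\<lambda>(c, v). c *s x + v"
  have "y \<in> ?f ` (UNIV \<times> span B)" if "y \<in> span (insert x B)" for y
  proof -
    obtain c where "y - c *s x \<in> span B"
      using \<open>y \<in> span (insert x B)\<close> by (auto simp: span_breakdown_eq)
    thus ?thesis
      by (intro image_eqI[of _ _ "(c, y - c *s x)"]) auto
  qed
  moreover have "c *s x + v \<in> span (insert x B)" if "v \<in> span B" for c v
    unfolding span_breakdown_eq using that by (intro exI[of _ c]) simp
  ultimately have "span (insert x B) = ?f ` (UNIV \<times> span B)"
    by auto
  moreover have "inj_on ?f (UNIV \<times> span B)"
  proof (rule inj_onI, clarify)
    fix c d v w
    assume vw: "v \<in> span B" "w \<in> span B" and eq: "c *s x + v = d *s x + w"
    have "(c - d) *s x = w - v"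
      using eq by (simp add: scale_left_diff_distrib algebra_simps)
    hence "(c - d) *s x \<in> span B"
      using vw by (simp add: span_diff)
    hence "inverse (c - d) *s (c - d) *s x \<in> span B"
      by (rule span_scale)
    hence "c = d"
      using assms by (cases "c = d") auto
    with eq show "c = d \<and> v = w"
      by simp
  qed
  ultimately show ?thesis
    by (simp add: card_image card_cartesian_product)
qed

lemma card_span: "card (span B) = CARD('a) ^ dim B"
  using finite[of B]
proof (induction B rule: finite_induct)
  case (insert x B)
  thus ?case
    by (cases "x \<in> span B") (simp_all add: span_redundant dim_insert card_span_insert)
qed simp

lemma card_subspace: "subspace S \<Longrightarrow> card S = CARD('a) ^ dim S"
  by (metis card_span span_eq_iff)

lemma dim_eq_if_card: "subspace S \<Longrightarrow> card S = CARD('a) ^ k \<Longrightarrow> dim S = k"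
  using CARD_field_gt_1[where ?'a = 'a] by (simp add: card_subspace)

lemma ex_nonzero_if_dim_pos: "dim S > 0 \<Longrightarrow> \<exists>x\<in>S. x \<noteq> 0"
  unfolding neq0_conv[symmetric] dim_eq_0 by blast

lemma inter_eq_if_dim_eq_Suc:
  assumes sub: "subspace Z" "subspace S" "subspace T" and "Z \<subseteq> S" "Z \<subseteq> T"
    and dim: "dim S = Suc (dim Z)" "dim T = Suc (dim Z)" and "S \<noteq> T"
  shows "S \<inter> T = Z"
proof -
  have inter: "subspace (S \<inter> T)"
    using sub by (simp add: subspace_inter)
  have "\<not> dim S \<le> dim (S \<inter> T)"
  proof
    assume "dim S \<le> dim (S \<inter> T)"
    hence "S \<inter> T = S"
      by (intro subspace_dim_equal inter sub) auto
    moreover have "S = T"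
      using calculation dim by (intro subspace_dim_equal sub) auto
    ultimately show False
      using \<open>S \<noteq> T\<close> by blast
  qed
  hence "dim (S \<inter> T) \<le> dim Z"
    using dim(1) by simp
  hence "Z = S \<inter> T"
    using \<open>Z \<subseteq> S\<close> \<open>Z \<subseteq> T\<close> by (intro subspace_dim_equal inter sub) auto
  thus ?thesis ..
qed

text \<open>The subspaces in \<open>F\<close> partition the vectors of their union outside \<open>Z\<close>.\<close>

lemma card_subspaces_over:
  assumes Z: "subspace Z" and F: "\<And>S. S \<in> F \<Longrightarrow> subspace S \<and> Z \<subseteq> S \<and> dim S = Suc (dim Z)"
    and card: "card (Z \<union> \<Union>F) = CARD('a) ^ (dim Z + k)"
  shows "card F = (\<Sum>i<k. CARD('a) ^ i)"
proof -
  let ?q = "CARD('a)"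
  have card_diff: "card (S - Z) = ?q ^ dim Z * (?q - 1)" if "S \<in> F" for S
    using F[OF that] Z
    by (simp add: card_Diff_subset card_subspace algebra_simps diff_mult_distrib2)
  have "S \<inter> T = Z" if "S \<in> F" "T \<in> F" "S \<noteq> T" for S T
    using F[OF that(1)] F[OF that(2)] Z \<open>S \<noteq> T\<close> by (intro inter_eq_if_dim_eq_Suc) auto
  hence "card (\<Union>S\<in>F. S - Z) = (\<Sum>S\<in>F. card (S - Z))"
    by (intro card_UN_disjoint) auto
  also have "\<dots> = ?q ^ dim Z * (card F * (?q - 1))"
    by (simp add: card_diff)
  finally have "card (Z \<union> (\<Union>S\<in>F. S - Z)) = ?q ^ dim Z * (card F * (?q - 1) + 1)"
    using Z by (subst card_Un_disjoint) (auto simp: card_subspace)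
  moreover have "Z \<union> (\<Union>S\<in>F. S - Z) = Z \<union> \<Union>F"
    by auto
  ultimately have "?q ^ dim Z * ?q ^ k = ?q ^ dim Z * (card F * (?q - 1) + 1)"
    using card by (simp add: power_add)
  hence "?q ^ k = card F * (?q - 1) + 1"
    by (subst (asm) mult_cancel1) simp
  thus ?thesis
    by (intro eq_geometric_sum CARD_field_gt_1)
qed

lemma ex_nonzero_in_hyperplane:
  assumes H: "subspace H" "dimension \<le> Suc (dim H)" and T: "subspace T" "dim T \<ge> 2"
  obtains x where "x \<in> H" "x \<in> T" "x \<noteq> 0"
proof (cases "T \<subseteq> H")
  case True
  moreover obtain x where "x \<in> T" "x \<noteq> 0"
    using ex_nonzero_if_dim_pos[of T] T(2) by auto
  ultimately show ?thesis
    using that by blast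
next
  case False
  then obtain x where x: "x \<in> T" "x \<notin> H"
    by blast
  have "\<not> T \<subseteq> span {x}"
    using dim_mono[of T "{x}"] T(2) by (auto split: if_splits)
  then obtain y where y: "y \<in> T" "y \<notin> span {x}"
    by blast
  have span_H: "span H = H"
    using H(1) by simp
  have "dim (insert x H) = Suc (dim H)"
    using x(2) unfolding dim_insert span_H by simp
  hence "span (insert x H) = UNIV"
    using H(2) dim_subset_UNIV[of "insert x H"] by (simp add: dim_eq_full)
  then obtain k where k: "y - k *s x \<in> H"
    using span_breakdown_eq[of y x H] span_H by auto
  moreover have "y - k *s x \<in> T"
    using x(1) y(1) T(1) by (intro subspace_diff subspace_scale)
  moreover have "y - k *s x \<noteq> 0"
    using y(2) span_scale[OF span_base, of x "{x}" k] by auto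
  ultimately show ?thesis
    by (rule that)
qed

lemma dim_kernel_functional:
  assumes "Vector_Spaces.linear scale (*) f" "subspace S" "x \<in> S" "f x \<noteq> 0"
  shows "dim S = Suc (dim {y \<in> S. f y = 0})"
proof -
  interpret f: Vector_Spaces.linear scale "(*)" f
    by fact
  have kernel: "subspace {y \<in> S. f y = 0}"
    using subspace_inter[OF assms(2) f.subspace_kernel] by (simp add: Int_def)
  have "y \<in> span (insert x {y \<in> S. f y = 0})" if "y \<in> S" for y
  proof -
    have "y - (f y / f x) *s x \<in> {y \<in> S. f y = 0}"
      using that assms(2-4) by (simp add: f.diff f.scale subspace_diff subspace_scale)
    thus ?thesis
      by (auto simp: span_breakdown_eq intro: span_base)
  qed
  moreover have "span (insert x {y \<in> S. f y = 0}) \<subseteq> S"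
    using assms(2,3) by (intro span_minimal) auto
  ultimately have "span (insert x {y \<in> S. f y = 0}) = S"
    by blast
  hence "dim S = dim (insert x {y \<in> S. f y = 0})"
    by (metis dim_span)
  moreover have "x \<notin> span {y \<in> S. f y = 0}"
    using assms(4) kernel by (metis (mono_tags, lifting) mem_Collect_eq span_eq_iff)
  ultimately show ?thesis
    by (simp add: dim_insert)
qed

lemma rank_nullity:
  assumes "Vector_Spaces.linear scale scale f"
  shows "dim (UNIV :: 'v set) = dim (range f) + dim {x. f x = 0}"
proof -
  interpret f: Vector_Spaces.linear scale scale f
    by fact
  have "CARD('v) = card (range f) * card {x. f x = 0}"
    using f.diff by (rule card_UNIV_eq_card_range_mult_card_kernel)
  hence "CARD('a) ^ dim (UNIV :: 'v set) = CARD('a) ^ (dim (range f) + dim {x. f x = 0})"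
    using f.subspace_image[OF subspace_UNIV] f.subspace_kernel subspace_UNIV
    by (simp only: card_subspace power_add)
  thus ?thesis
    using CARD_field_gt_1[where ?'a = 'a] by (simp del: dim_UNIV)
qed

lemma ex_nonzero_in_kernel_functional:
  assumes "Vector_Spaces.linear scale (*) f" "subspace T" "dim T \<ge> 2"
  obtains x where "f x = 0" "x \<in> T" "x \<noteq> 0"
proof -
  interpret f: Vector_Spaces.linear scale "(*)" f
    by fact
  have "dimension \<le> Suc (dim {x. f x = 0})"
  proof (cases "\<exists>x. f x \<noteq> 0")
    case True
    thus ?thesis
      using dim_kernel_functional[OF assms(1) subspace_UNIV UNIV_I] by (auto simp: dimension_def)
  qed (simp add: dimension_def)
  from ex_nonzero_in_hyperplane[OF f.subspace_kernel this assms(2,3)] show ?thesis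
    using that by blast
qed

end

section \<open>Geometries of isotropic subspaces\<close>

locale isotropic_geometry = finite_vector_space scale
  for scale :: "'a :: {field, finite} \<Rightarrow> 'v :: {ab_group_add, finite} \<Rightarrow> 'v" (infixr "*s" 75) +
  fixes perp :: "'v \<Rightarrow> 'v \<Rightarrow> bool"
  assumes perp_0: "perp 0 0"
    and perp_sym: "perp x y \<Longrightarrow> perp y x"
    and subspace_perp: "perp x x \<Longrightarrow> subspace {y. perp x y}"
    and perp_null: "x \<noteq> 0 \<Longrightarrow> perp x x \<Longrightarrow> perp x y \<Longrightarrow> perp y y"
    and dim_perp: "x \<noteq> 0 \<Longrightarrow> perp x x \<Longrightarrow> dim {y. perp x y} = 3"
begin

definition isotropic :: "'v set \<Rightarrow> bool" where
  "isotropic S \<longleftrightarrow> subspace S \<and> (\<forall>x\<in>S. \<forall>y\<in>S. perp x y)"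

definition points :: "'v set set" where
  "points = {p. isotropic p \<and> dim p = 1}"

definition lines :: "'v set set" where
  "lines = {l. isotropic l \<and> dim l = 2}"

definition inc :: "('v set \<times> 'v set) set" where
  "inc = {(p, l). p \<in> points \<and> l \<in> lines \<and> p \<subseteq> l}"

lemma isotropic_span:
  assumes "\<And>x y. x \<in> B \<Longrightarrow> y \<in> B \<Longrightarrow> perp x y"
  shows "isotropic (span B)"
proof -
  have perp_B: "perp x u" if "x \<in> B" "u \<in> span B" for x u
    using span_minimal[of B "{y. perp x y}"] subspace_perp[of x] assms that by blast
  have perp_self: "perp u u" if "u \<in> span B" for u
  proof (cases "B \<subseteq> {0}")
    case True
    hence "span B \<subseteq> {0}"
      using span_mono[OF True] by simp
    thus ?thesis
      using that perp_0 by auto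
  next
    case False
    then obtain x where "x \<in> B" "x \<noteq> 0"
      by blast
    thus ?thesis
      using perp_null assms perp_B that by blast
  qed
  have "span B \<subseteq> {v. perp u v}" if "u \<in> span B" for u
    using perp_B[OF _ that] perp_sym by (intro span_minimal subspace_perp perp_self[OF that]) blast
  thus ?thesis
    by (auto simp: isotropic_def)
qed

lemma span_singleton_in_points: "x \<noteq> 0 \<Longrightarrow> perp x x \<Longrightarrow> span {x} \<in> points"
  using isotropic_span[of "{x}"] by (auto simp: points_def)

lemma span_pair_in_lines:
  assumes "x \<noteq> 0" "perp x x" "perp x y" "y \<notin> span {x}"
  shows "span {x, y} \<in> lines"
proof -
  have "dim {x, y} = 2"
    using assms(1,4) dim_insert[of y "{x}"] by (simp add: insert_commute)
  moreover have "perp y y"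
    using assms perp_null by blast
  ultimately show ?thesis
    using isotropic_span[of "{x, y}"] assms(2,3) perp_sym by (auto simp: lines_def)
qed

lemma pointE:
  assumes "p \<in> points"
  obtains x where "p = span {x}" "x \<noteq> 0" "perp x x"
proof -
  have p: "subspace p" "dim p = 1"
    using assms by (auto simp: points_def isotropic_def)
  then obtain x where x: "x \<in> p" "x \<noteq> 0"
    using ex_nonzero_if_dim_pos[of p] by auto
  have "span {x} = p"
    using x p by (intro subspace_dim_equal span_minimal) auto
  thus ?thesis
    using that x assms by (auto simp: points_def isotropic_def)
qed

lemma lineD:
  assumes "l \<in> lines"
  shows "subspace l" "dim l = 2" "x \<in> l \<Longrightarrow> y \<in> l \<Longrightarrow> perp x y"
  using assms by (auto simp: lines_def isotropic_def)

lemma inc_span_singleton_iff: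
  assumes "x \<noteq> 0"
  shows "(span {x}, l) \<in> inc \<longleftrightarrow> l \<in> lines \<and> x \<in> l"
proof
  assume l: "l \<in> lines \<and> x \<in> l"
  hence "span {x} \<in> points" "span {x} \<subseteq> l"
    using assms lineD[of l] span_minimal[of "{x}" l] by (auto intro!: span_singleton_in_points)
  thus "(span {x}, l) \<in> inc"
    using l by (simp add: inc_def)
qed (use span_base[of x "{x}"] in \<open>auto simp: inc_def\<close>)

lemma card_points:
  assumes "card {x. perp x x} = CARD('a) ^ k"
  shows "card points = (\<Sum>i<k. CARD('a) ^ i)"
proof (rule card_subspaces_over[of "{0}"])
  have "x \<in> {0} \<union> \<Union>points" if "perp x x" for x
    using span_singleton_in_points[of x] span_base[of x "{x}"] that by blast
  moreover have "perp x x" if "x \<in> {0} \<union> \<Union>points" for x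
    using that perp_0 by (auto simp: points_def isotropic_def)
  ultimately have "{0} \<union> \<Union>points = {x. perp x x}"
    by blast
  thus "card ({0} \<union> \<Union>points) = CARD('a) ^ (dim {0} + k)"
    using assms by simp
qed (auto simp: points_def isotropic_def subspace_0)

lemma card_points_on_line:
  assumes "l \<in> lines"
  shows "card (inc\<inverse> `` {l}) = CARD('a) + 1"
proof -
  note l = lineD[OF assms]
  have "x \<in> {0} \<union> \<Union>(inc\<inverse> `` {l})" if "x \<in> l" for x
    using that inc_span_singleton_iff[of x l] assms span_base[of x "{x}"] by blast
  moreover have "{0} \<union> \<Union>(inc\<inverse> `` {l}) \<subseteq> l"
    using subspace_0[OF l(1)] by (auto simp: inc_def)
  ultimately have "{0} \<union> \<Union>(inc\<inverse> `` {l}) = l"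
    by blast
  hence "card (inc\<inverse> `` {l}) = (\<Sum>i<2. CARD('a) ^ i)"
    using l by (intro card_subspaces_over[of "{0}"])
      (auto simp: inc_def points_def isotropic_def subspace_0 card_subspace power2_eq_square)
  thus ?thesis
    by (simp add: numeral_2_eq_2)
qed

lemma card_lines_on_point:
  assumes "p \<in> points"
  shows "card (inc `` {p}) = CARD('a) + 1"
proof -
  obtain x where x: "p = span {x}" "x \<noteq> 0" "perp x x"
    using pointE[OF assms] .
  have "y \<in> p \<union> \<Union>(inc `` {p})" if "perp x y" for y
    using that span_pair_in_lines[OF x(2,3), of y] inc_span_singleton_iff[OF x(2), of "span {x, y}"]
      span_base[of _ "{x, y}"] unfolding x(1) by blast
  moreover have "perp x y" if "y \<in> p \<union> \<Union>(inc `` {p})" for y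
    using that
  proof
    assume "y \<in> p"
    thus ?thesis
      using assms span_base[of x "{x}"] unfolding x(1) points_def isotropic_def by blast
  next
    assume "y \<in> \<Union>(inc `` {p})"
    thus ?thesis
      using lineD(3) by (auto simp: x(1) inc_span_singleton_iff[OF x(2)])
  qed
  ultimately have "p \<union> \<Union>(inc `` {p}) = {y. perp x y}"
    by blast
  moreover have "card {y. perp x y} = CARD('a) ^ (dim p + 2)"
    using x by (simp add: card_subspace subspace_perp dim_perp numeral_3_eq_3 numeral_2_eq_2)
  ultimately have "card (inc `` {p}) = (\<Sum>i<2. CARD('a) ^ i)"
    using assms by (intro card_subspaces_over[of p])
      (auto simp: inc_def points_def lines_def isotropic_def)
  thus ?thesis
    by (simp add: numeral_2_eq_2)
qed

lemma regular_incidence_inc: "regular_incidence points lines inc (CARD('a) + 1) (CARD('a) + 1)"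
  using card_points_on_line card_lines_on_point by (auto simp: regular_incidence_def inc_def)

lemma card_lines: "card lines = card points"
  using card_incidences[OF regular_incidence_inc] by (simp only: mult_cancel2 finite) simp

lemma ex_bigraph_if_has_diameter:
  assumes "has_diameter (points <+> lines) (incidence_graph inc) d" "d \<ge> 2"
    and "card {x. perp x x} = CARD('a) ^ k"
  shows "ex_bigraph (CARD('a) + 1) (2 * (CARD('a) + 1)) d (3 * (\<Sum>i<k. CARD('a) ^ i))"
  using ex_bigraph_replicate_points[OF _ _ regular_incidence_inc _ _ assms(1,2), where ?'c = bool]
    card_points[OF assms(3)] by (simp add: card_lines mult.commute)

definition perp_graph :: "'v rel" where
  "perp_graph = {(x, y). x \<noteq> 0 \<and> y \<noteq> 0 \<and> perp x x \<and> perp x y}"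

lemma ex_line_through:
  assumes "x \<noteq> 0" "perp x x" "perp x y"
  shows "\<exists>l\<in>lines. x \<in> l \<and> y \<in> l"
proof (cases "y \<in> span {x}")
  case True
  obtain l where "(span {x}, l) \<in> inc"
    using regular_incidence_imp_Domain_Range(1)[OF regular_incidence_inc]
      span_singleton_in_points assms(1,2) by auto
  hence "l \<in> lines" "span {x} \<subseteq> l"
    by (simp_all add: inc_def)
  thus ?thesis
    using True span_base[of x "{x}"] by blast
next
  case False
  thus ?thesis
    using span_pair_in_lines[OF assms] span_base[of _ "{x, y}"] by blast
qed

lemma collinear_span_iff: "(span {x}, span {y}) \<in> collinear inc \<longleftrightarrow> (x, y) \<in> perp_graph"
proof (cases "x = 0 \<or> y = 0")
  case True
  thus ?thesis
    by (auto simp: collinear_def inc_def points_def perp_graph_def)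
next
  case False
  hence "(span {x}, span {y}) \<in> collinear inc \<longleftrightarrow> (\<exists>l\<in>lines. x \<in> l \<and> y \<in> l)"
    by (auto simp: collinear_def inc_span_singleton_iff)
  also have "\<dots> \<longleftrightarrow> perp x x \<and> perp x y"
    using ex_line_through[of x y] lineD(3) False by blast
  finally show ?thesis
    using False by (simp add: perp_graph_def)
qed

lemma relpow_collinear_span_iff:
  "(span {x}, span {y}) \<in> collinear inc ^^ Suc n \<longleftrightarrow> (x, y) \<in> perp_graph ^^ Suc n"
proof -
  have "points \<subseteq> range (\<lambda>x. span {x})"
    by (blast elim: pointE)
  hence "collinear inc \<subseteq> range (\<lambda>x. span {x}) \<times> range (\<lambda>x. span {x})"
    by (auto simp: collinear_def inc_def)
  moreover have "inv_image (collinear inc) (\<lambda>x. span {x}) = perp_graph"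
    by (auto simp: inv_image_def collinear_span_iff)
  ultimately have "perp_graph ^^ Suc n = inv_image (collinear inc ^^ Suc n) (\<lambda>x. span {x})"
    using relpow_Suc_inv_image by metis
  thus ?thesis
    by (simp only: in_inv_image)
qed

lemma has_diameter_even:
  assumes near: "\<And>x l. x \<noteq> 0 \<Longrightarrow> perp x x \<Longrightarrow> l \<in> lines \<Longrightarrow> \<exists>w\<in>l. (x, w) \<in> perp_graph ^^ Suc n"
    and far: "x \<noteq> 0" "perp x x" "y \<noteq> 0" "perp y y" "(x, y) \<notin> perp_graph ^^ Suc n"
  shows "has_diameter (points <+> lines) (incidence_graph inc) (2 * n + 4)"
proof -
  have eq: "2 * n + 4 = 2 * Suc n + 2"
    by simp
  show ?thesis
    unfolding eq
  proof (rule has_diameter_incidence_graph_even)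
    show "inc \<subseteq> points \<times> lines" "points \<subseteq> Domain inc" "lines \<subseteq> Range inc"
      using regular_incidence_imp_Domain_Range[OF regular_incidence_inc] by (auto simp: inc_def)
    show "span {x} \<in> points" "span {y} \<in> points" "(span {x}, span {y}) \<notin> collinear inc ^^ Suc n"
      using far
      by (simp_all add: span_singleton_in_points relpow_collinear_span_iff del: relpow.simps)
    fix p l assume p: "p \<in> points" and l: "l \<in> lines"
    obtain v where v: "p = span {v}" "v \<noteq> 0" "perp v v"
      using pointE[OF p] .
    obtain w where w: "w \<in> l" "(v, w) \<in> perp_graph ^^ Suc n"
      using near[OF v(2,3) l] by blast
    have "w \<noteq> 0"
      using w(2) by (auto simp: perp_graph_def)
    thus "(p, l) \<in> collinear inc ^^ Suc n O inc"
      using w l unfolding v(1)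
      by (intro relcompI[of _ "span {w}"])
        (simp_all add: relpow_collinear_span_iff inc_span_singleton_iff del: relpow.simps)
  qed
qed

lemma perp_graph_relpow_2_iff:
  "(x, y) \<in> perp_graph ^^ Suc 1 \<longleftrightarrow>
     x \<noteq> 0 \<and> y \<noteq> 0 \<and> perp x x \<and> (\<exists>z. z \<noteq> 0 \<and> perp x z \<and> perp z y)"
  using perp_null by (auto simp: perp_graph_def)

end

section \<open>The projective plane\<close>

locale projective_plane = finite_vector_space scale
  for scale :: "'a :: {field, finite} \<Rightarrow> 'v :: {ab_group_add, finite} \<Rightarrow> 'v" (infixr "*s" 75) +
  assumes card_UNIV: "CARD('v) = CARD('a) ^ 3"
begin

lemma dim_UNIV_eq_3: "dim (UNIV :: 'v set) = 3"
  using card_UNIV by (intro dim_eq_if_card) auto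

sublocale isotropic_geometry scale "\<lambda>_ _. True"
  by unfold_locales (simp_all add: dim_UNIV_eq_3 del: dim_UNIV)

lemma has_diameter_3: "has_diameter (points <+> lines) (incidence_graph inc) 3"
proof -
  have "(p, p') \<in> collinear inc" if "p \<in> points" "p' \<in> points" for p p'
    using that by (elim pointE) (simp add: collinear_span_iff perp_graph_def)
  moreover have "(l, l') \<in> collinear (inc\<inverse>)" if l: "l \<in> lines" "l' \<in> lines" for l l'
  proof -
    have "dimension \<le> Suc (dim l)" "dim l' \<ge> 2"
      using dim_UNIV_eq_3 lineD(2)[OF l(1)] lineD(2)[OF l(2)] by (simp_all add: dimension_def)
    from ex_nonzero_in_hyperplane[OF lineD(1)[OF l(1)] this(1) lineD(1)[OF l(2)] this(2)]
    obtain x where "x \<in> l" "x \<in> l'" "x \<noteq> 0" .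
    hence "(span {x}, l) \<in> inc" "(span {x}, l') \<in> inc"
      using l by (simp_all add: inc_span_singleton_iff)
    thus ?thesis
      by (auto simp: collinear_def)
  qed
  moreover obtain p l where "p \<in> points" "l \<in> lines" "(p, l) \<notin> inc"
  proof -
    obtain x :: 'v where "x \<noteq> 0"
      using ex_nonzero_if_dim_pos[of UNIV] dim_UNIV_eq_3 by (metis zero_less_numeral)
    then obtain l where l: "l \<in> lines"
      using ex_line_through[of x x] by blast
    have "l \<noteq> UNIV"
      using lineD(2)[OF l] dim_UNIV_eq_3 by auto
    then obtain x where "x \<notin> l"
      by blast
    moreover have "x \<noteq> 0"
      using calculation subspace_0[OF lineD(1)[OF l]] by blast
    ultimately show ?thesis
      using that[of "span {x}" l] l by (simp add: span_singleton_in_points inc_span_singleton_iff)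
  qed
  moreover have "inc \<subseteq> points \<times> lines"
    by (auto simp: inc_def)
  ultimately show ?thesis
    by (intro has_diameter_incidence_graph_3) auto
qed

lemma ex_bigraph_projective_plane:
  "ex_bigraph (CARD('a) + 1) (2 * (CARD('a) + 1)) 3 (3 * (\<Sum>i<3. CARD('a) ^ i))"
  by (intro ex_bigraph_if_has_diameter has_diameter_3) (simp_all add: card_UNIV)

end

definition scale3 :: "'a :: times \<Rightarrow> 'a \<times> 'a \<times> 'a \<Rightarrow> 'a \<times> 'a \<times> 'a" where
  "scale3 c = (\<lambda>(x, y, z). (c * x, c * y, c * z))"

lemma projective_plane_scale3: "projective_plane (scale3 :: 'a :: {field, finite} \<Rightarrow> _)"
  by unfold_locales (auto simp: scale3_def algebra_simps power3_eq_cube)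

section \<open>The symplectic quadrangle\<close>

locale symplectic_space = finite_vector_space scale
  for scale :: "'a :: {field, finite} \<Rightarrow> 'v :: {ab_group_add, finite} \<Rightarrow> 'v" (infixr "*s" 75) +
  fixes form :: "'v \<Rightarrow> 'v \<Rightarrow> 'a"
  assumes card_UNIV: "CARD('v) = CARD('a) ^ 4"
    and linear_form: "Vector_Spaces.linear scale (*) (form x)"
    and alternating: "form x x = 0"
    and skew: "form y x = - form x y"
    and nondegenerate: "x \<noteq> 0 \<Longrightarrow> \<exists>y. form x y \<noteq> 0"
begin

lemma dim_UNIV_eq_4: "dim (UNIV :: 'v set) = 4"
  using card_UNIV by (intro dim_eq_if_card) auto

lemma dim_orthogonal:
  assumes "x \<noteq> 0"
  shows "dim {y. form x y = 0} = 3"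
proof -
  obtain y where "form x y \<noteq> 0"
    using nondegenerate[OF assms] by blast
  thus ?thesis
    using dim_kernel_functional[OF linear_form subspace_UNIV UNIV_I] dim_UNIV_eq_4 by simp
qed

lemma subspace_orthogonal: "subspace {y. form x y = 0}"
proof -
  interpret form: Vector_Spaces.linear scale "(*)" "form x"
    by (rule linear_form)
  show ?thesis
    by (rule form.subspace_kernel)
qed

sublocale isotropic_geometry scale "\<lambda>x y. form x y = 0"
proof
  show "form x y = 0 \<Longrightarrow> form y x = 0" for x y
    by (simp add: skew[of y x])
qed (simp_all add: alternating subspace_orthogonal dim_orthogonal)

lemma has_diameter_4: "has_diameter (points <+> lines) (incidence_graph inc) 4"
proof -
  have near: "\<exists>w\<in>l. (x, w) \<in> perp_graph ^^ Suc 0" if "x \<noteq> 0" "l \<in> lines" for x l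
  proof -
    have "dim l \<ge> 2"
      using lineD(2)[OF that(2)] by simp
    from ex_nonzero_in_kernel_functional[OF linear_form lineD(1)[OF that(2)] this]
    obtain w where "form x w = 0" "w \<in> l" "w \<noteq> 0" .
    thus ?thesis
      using that(1) by (auto simp: perp_graph_def alternating)
  qed
  obtain x :: 'v where x: "x \<noteq> 0"
    using ex_nonzero_if_dim_pos[of UNIV] dim_UNIV_eq_4 by (metis zero_less_numeral)
  then obtain y where xy: "form x y \<noteq> 0"
    using nondegenerate by blast
  hence "y \<noteq> 0"
    using subspace_0[OF subspace_orthogonal[of x]] by auto
  thus ?thesis
    using has_diameter_even[of 0 x y] near x xy by (simp add: alternating perp_graph_def)
qed

lemma ex_bigraph_symplectic_quadrangle:
  "ex_bigraph (CARD('a) + 1) (2 * (CARD('a) + 1)) 4 (3 * (\<Sum>i<4. CARD('a) ^ i))"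
  by (intro ex_bigraph_if_has_diameter has_diameter_4) (simp_all add: alternating card_UNIV)

end

definition scale4 :: "'a :: times \<Rightarrow> 'a \<times> 'a \<times> 'a \<times> 'a \<Rightarrow> 'a \<times> 'a \<times> 'a \<times> 'a" where
  "scale4 c = (\<lambda>(x, y, z, w). (c * x, c * y, c * z, c * w))"

definition symplectic_form :: "'a :: comm_ring \<times> 'a \<times> 'a \<times> 'a \<Rightarrow> 'a \<times> 'a \<times> 'a \<times> 'a \<Rightarrow> 'a" where
  "symplectic_form = (\<lambda>(x\<^sub>1, x\<^sub>2, x\<^sub>3, x\<^sub>4) (y\<^sub>1, y\<^sub>2, y\<^sub>3, y\<^sub>4).
    x\<^sub>1 * y\<^sub>2 - x\<^sub>2 * y\<^sub>1 + x\<^sub>3 * y\<^sub>4 - x\<^sub>4 * y\<^sub>3)"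

lemma vector_space_self: "vector_space ((*) :: 'a :: field \<Rightarrow> 'a \<Rightarrow> 'a)"
  by unfold_locales (simp_all add: algebra_simps)

lemma symplectic_space_symplectic_form:
  "symplectic_space (scale4 :: 'a :: {field, finite} \<Rightarrow> _) symplectic_form"
proof -
  interpret finite_vector_space "scale4 :: 'a \<Rightarrow> _"
    by unfold_locales (auto simp: scale4_def algebra_simps)
  show ?thesis
  proof (intro symplectic_space.intro symplectic_space_axioms.intro finite_vector_space_axioms)
    show "\<exists>y. symplectic_form x y \<noteq> 0" if "x \<noteq> 0" for x :: "'a \<times> 'a \<times> 'a \<times> 'a"
    proof -
      obtain a b c d where x: "x = (a, b, c, d)"
        by (cases x)
      have "symplectic_form x (0, 1, 0, 0) = a" "symplectic_form x (1, 0, 0, 0) = - b"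
        "symplectic_form x (0, 0, 0, 1) = c" "symplectic_form x (0, 0, 1, 0) = - d"
        by (simp_all add: x symplectic_form_def)
      thus ?thesis
        using \<open>x \<noteq> 0\<close> x by (metis neg_equal_0_iff_equal zero_prod_def)
    qed
    show "Vector_Spaces.linear scale4 (*) (symplectic_form x)" for x :: "'a \<times> 'a \<times> 'a \<times> 'a"
      unfolding Vector_Spaces.linear_iff
      by (cases x, intro conjI vector_space_axioms vector_space_self)
        (auto simp: symplectic_form_def scale4_def algebra_simps)
  qed (auto simp: symplectic_form_def algebra_simps power4_eq_xxxx)
qed

section \<open>The split octonions\<close>

text \<open>
  The octonion \<open>(a, v, w, b)\<close> is Zorn's vector matrix with diagonal entries \<open>a, b\<close> and
  off-diagonal entries \<open>v, w\<close> in three-dimensional space.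
\<close>

type_synonym 'a octonion = "'a \<times> ('a \<times> 'a \<times> 'a) \<times> ('a \<times> 'a \<times> 'a) \<times> 'a"

definition dot3 :: "'a :: comm_ring \<times> 'a \<times> 'a \<Rightarrow> 'a \<times> 'a \<times> 'a \<Rightarrow> 'a" where
  "dot3 = (\<lambda>(x\<^sub>1, x\<^sub>2, x\<^sub>3) (y\<^sub>1, y\<^sub>2, y\<^sub>3). x\<^sub>1 * y\<^sub>1 + x\<^sub>2 * y\<^sub>2 + x\<^sub>3 * y\<^sub>3)"

definition cross3 :: "'a :: comm_ring \<times> 'a \<times> 'a \<Rightarrow> 'a \<times> 'a \<times> 'a \<Rightarrow> 'a \<times> 'a \<times> 'a" where
  "cross3 = (\<lambda>(x\<^sub>1, x\<^sub>2, x\<^sub>3) (y\<^sub>1, y\<^sub>2, y\<^sub>3).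
    (x\<^sub>2 * y\<^sub>3 - x\<^sub>3 * y\<^sub>2, x\<^sub>3 * y\<^sub>1 - x\<^sub>1 * y\<^sub>3, x\<^sub>1 * y\<^sub>2 - x\<^sub>2 * y\<^sub>1))"

definition oct_scale :: "'a :: comm_ring \<Rightarrow> 'a octonion \<Rightarrow> 'a octonion" where
  "oct_scale c = (\<lambda>(a, v, w, b). (c * a, scale3 c v, scale3 c w, c * b))"

definition oct_mult :: "'a :: comm_ring octonion \<Rightarrow> 'a octonion \<Rightarrow> 'a octonion" (infixl "\<star>" 70) where
  "oct_mult = (\<lambda>(a, v, w, b) (a', v', w', b').
    (a * a' + dot3 v w', scale3 a v' + scale3 b' v + cross3 w w',
     scale3 a' w + scale3 b w' - cross3 v v', b * b' + dot3 w v'))"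

definition oct_conj :: "'a :: comm_ring octonion \<Rightarrow> 'a octonion" where
  "oct_conj = (\<lambda>(a, v, w, b). (b, - v, - w, a))"

definition oct_trace :: "'a :: comm_ring octonion \<Rightarrow> 'a" where
  "oct_trace = (\<lambda>(a, v, w, b). a + b)"

definition oct_norm :: "'a :: comm_ring octonion \<Rightarrow> 'a" where
  "oct_norm = (\<lambda>(a, v, w, b). a * b - dot3 v w)"

lemmas octonion_defs = dot3_def cross3_def scale3_def oct_scale_def oct_mult_def oct_conj_def
  oct_trace_def oct_norm_def

lemma oct_mult_0 [simp]: "x \<star> 0 = 0" "0 \<star> x = 0"
  by (cases x, simp add: octonion_defs zero_prod_def split_beta)+

lemma oct_trace_0 [simp]: "oct_trace 0 = 0"
  by (simp add: octonion_defs zero_prod_def)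

lemma oct_scale_eq_0_iff: "oct_scale c x = 0 \<longleftrightarrow> c = 0 \<or> x = 0" for c :: "'a :: field"
  by (cases x) (auto simp: octonion_defs zero_prod_def)

lemma finite_vector_space_oct_scale: "finite_vector_space (oct_scale :: 'a :: {field, finite} \<Rightarrow> _)"
  by unfold_locales (auto simp: octonion_defs algebra_simps)

lemma linear_oct_mult: "Vector_Spaces.linear oct_scale oct_scale ((\<star>) x)"
  for x :: "'a :: {field, finite} octonion"
proof -
  interpret finite_vector_space "oct_scale :: 'a \<Rightarrow> _"
    by (rule finite_vector_space_oct_scale)
  show ?thesis
    unfolding Vector_Spaces.linear_iff
    by (cases x, intro conjI vector_space_axioms) (auto simp: octonion_defs algebra_simps)
qed

lemma linear_oct_trace:
  "Vector_Spaces.linear oct_scale (*) (oct_trace :: 'a :: {field, finite} octonion \<Rightarrow> 'a)"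
proof -
  interpret finite_vector_space "oct_scale :: 'a \<Rightarrow> _"
    by (rule finite_vector_space_oct_scale)
  show ?thesis
    unfolding Vector_Spaces.linear_iff
    by (intro conjI vector_space_axioms vector_space_self) (auto simp: octonion_defs algebra_simps)
qed

lemma linear_oct_trace_mult: "Vector_Spaces.linear oct_scale (*) (\<lambda>y. oct_trace (x \<star> y))"
  for x :: "'a :: {field, finite} octonion"
  using Vector_Spaces.linear_compose[OF linear_oct_mult linear_oct_trace, of x] by (simp add: o_def)

lemma oct_conj_mult: "oct_conj (x \<star> y) = oct_conj y \<star> oct_conj x"
  by (cases x; cases y) (auto simp: octonion_defs algebra_simps)

lemma oct_conj_eq_uminus: "oct_trace x = 0 \<Longrightarrow> oct_conj x = - x"
  by (cases x) (auto simp: octonion_defs add_eq_0_iff)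

lemma oct_mult_uminus: "(- x) \<star> y = - (x \<star> y)" "x \<star> (- y) = - (x \<star> y)"
  by (cases x; cases y; auto simp: octonion_defs algebra_simps)+

lemma oct_left_alternative: "x \<star> (x \<star> y) = (x \<star> x) \<star> y"
  by (cases x; cases y) (auto simp: octonion_defs algebra_simps)

lemma oct_right_alternative: "(x \<star> y) \<star> y = x \<star> (y \<star> y)"
  by (cases x; cases y) (auto simp: octonion_defs algebra_simps)

lemma oct_mult_conj_right: "(x \<star> y) \<star> oct_conj y = oct_scale (oct_norm y) x"
  by (cases x; cases y) (auto simp: octonion_defs algebra_simps)

lemma oct_conj_mult_polar:
  "oct_conj x \<star> (z \<star> y) + oct_conj z \<star> (x \<star> y) = oct_scale (oct_trace (oct_conj x \<star> z)) y"
  by (cases x; cases y; cases z) (auto simp: octonion_defs algebra_simps)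

lemma oct_square_if_trace_0: "oct_trace x = 0 \<Longrightarrow> x \<star> x = oct_scale (- oct_norm x) (1, 0, 0, 1)"
  for x :: "'a :: comm_ring_1 octonion"
  by (cases x) (auto simp: octonion_defs zero_prod_def add_eq_0_iff algebra_simps)

lemma ex_oct_trace_mult_nonzero:
  fixes x :: "'a :: comm_ring_1 octonion"
  assumes "x \<noteq> 0"
  shows "\<exists>y. oct_trace (x \<star> y) \<noteq> 0"
proof (rule ccontr)
  assume traces: "\<nexists>y. oct_trace (x \<star> y) \<noteq> 0"
  obtain a v\<^sub>1 v\<^sub>2 v\<^sub>3 w\<^sub>1 w\<^sub>2 w\<^sub>3 b where x: "x = (a, (v\<^sub>1, v\<^sub>2, v\<^sub>3), (w\<^sub>1, w\<^sub>2, w\<^sub>3), b)"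
    by (metis prod.exhaust)
  have "oct_trace (x \<star> (1, 0, 0, 0)) = a" "oct_trace (x \<star> (0, 0, 0, 1)) = b"
    "oct_trace (x \<star> (0, 0, (1, 0, 0), 0)) = v\<^sub>1" "oct_trace (x \<star> (0, 0, (0, 1, 0), 0)) = v\<^sub>2"
    "oct_trace (x \<star> (0, 0, (0, 0, 1), 0)) = v\<^sub>3" "oct_trace (x \<star> (0, (1, 0, 0), 0, 0)) = w\<^sub>1"
    "oct_trace (x \<star> (0, (0, 1, 0), 0, 0)) = w\<^sub>2" "oct_trace (x \<star> (0, (0, 0, 1), 0, 0)) = w\<^sub>3"
    by (simp_all add: x octonion_defs zero_prod_def)
  hence "x = 0"
    using traces by (simp add: x zero_prod_def)
  thus False
    using assms by simp
qed

section \<open>The split Cayley hexagon\<close>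

lemma card_hyperbolic_sum_zeros:
  fixes f :: "'z :: finite \<Rightarrow> 'a :: {field, finite}"
  assumes "CARD('a) * card {z. f z = 0} = CARD('z)"
  shows "CARD('a) * card {(v, w, z). v * w + f z = 0} = CARD('a \<times> 'a \<times> 'z)"
proof -
  have fibre: "card {(w, z). v * w + f z = 0} = CARD('z)" for v :: 'a
  proof (cases "v = 0")
    case True
    hence "{(w, z). v * w + f z = 0} = UNIV \<times> {z. f z = 0}"
      by auto
    thus ?thesis
      using assms by (simp add: card_cartesian_product)
  next
    case False
    have "{(w, z). v * w + f z = 0} = (\<lambda>z. (- f z / v, z)) ` UNIV"
      using False by (auto simp: image_iff field_simps eq_neg_iff_add_eq_0)
    thus ?thesis
      by (simp add: card_image inj_on_def)
  qed
  have "{(v, w, z). v * w + f z = 0} = Sigma UNIV (\<lambda>v. {(w, z). v * w + f z = 0})"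
    by auto
  hence "card {(v, w, z). v * w + f z = 0} = (\<Sum>v::'a\<in>UNIV. card {(w, z). v * w + f z = 0})"
    by (simp only: card_SigmaI finite ball_UNIV simp_thms)
  thus ?thesis
    by (simp add: fibre)
qed

lemma card_quadric_zeros:
  "card {(v\<^sub>1, w\<^sub>1, v\<^sub>2, w\<^sub>2, v\<^sub>3, w\<^sub>3, a :: 'a :: {field, finite}).
      v\<^sub>1 * w\<^sub>1 + (v\<^sub>2 * w\<^sub>2 + (v\<^sub>3 * w\<^sub>3 + a * a)) = 0} = CARD('a) ^ 6"
proof -
  have "{a :: 'a. a * a = 0} = {0}"
    by auto
  hence "CARD('a) * card {a :: 'a. a * a = 0} = CARD('a)"
    by simp
  note one_pair = card_hyperbolic_sum_zeros[OF this, unfolded case_prod_unfold]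
  note two_pairs = card_hyperbolic_sum_zeros[OF one_pair, unfolded case_prod_unfold]
  note three_pairs = card_hyperbolic_sum_zeros[OF two_pairs]
  thus ?thesis
    by (simp add: case_prod_unfold eval_nat_numeral)
qed

definition oct_perp :: "'a :: comm_ring octonion \<Rightarrow> 'a octonion \<Rightarrow> bool" where
  "oct_perp x y \<longleftrightarrow> oct_trace x = 0 \<and> oct_trace y = 0 \<and> x \<star> y = 0"

lemma oct_perp_sym:
  assumes "oct_perp x y"
  shows "oct_perp y x"
proof -
  have "y \<star> x = oct_conj y \<star> oct_conj x"
    using assms by (simp add: oct_perp_def oct_conj_eq_uminus oct_mult_uminus)
  also have "\<dots> = oct_conj (x \<star> y)"
    by (simp add: oct_conj_mult)
  also have "\<dots> = 0"
    using assms by (simp add: oct_perp_def oct_conj_eq_uminus)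
  finally show ?thesis
    using assms by (simp add: oct_perp_def)
qed

lemma oct_perp_self_iff: "oct_perp x x \<longleftrightarrow> oct_trace x = 0 \<and> oct_norm x = 0"
  for x :: "'a :: field octonion"
proof -
  have "(1, 0, 0, 1) \<noteq> (0 :: 'a octonion)"
    by (simp add: zero_prod_def)
  thus ?thesis
    by (auto simp: oct_perp_def oct_square_if_trace_0 oct_scale_eq_0_iff)
qed

lemma oct_perp_null:
  fixes x :: "'a :: field octonion"
  assumes "x \<noteq> 0" "oct_perp x y"
  shows "oct_perp y y"
proof -
  have "oct_scale (oct_norm y) x = 0"
    using assms(2) by (simp add: oct_perp_def flip: oct_mult_conj_right)
  thus ?thesis
    using assms by (simp add: oct_scale_eq_0_iff oct_perp_self_iff) (simp add: oct_perp_def)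
qed

lemma oct_perp_mult:
  assumes "oct_perp x x" "oct_perp y y" "oct_trace (x \<star> y) = 0"
  shows "oct_perp x (x \<star> y)" "oct_perp (x \<star> y) y"
  using assms by (simp_all add: oct_perp_def oct_left_alternative oct_right_alternative)

lemma ex_oct_perp_between:
  assumes "x \<noteq> 0" "oct_perp x x" "oct_perp y y" "oct_trace (x \<star> y) = 0"
  shows "\<exists>z. z \<noteq> 0 \<and> oct_perp x z \<and> oct_perp z y"
proof (cases "x \<star> y = 0")
  case True
  thus ?thesis
    using assms by (intro exI[of _ x]) (simp add: oct_perp_def)
next
  case False
  thus ?thesis
    using oct_perp_mult[OF assms(2-4)] by blast
qed

text \<open>
  If \<open>x y = 0\<close>, polarizing \<open>conj x (x y) = N(x) y\<close> at some \<open>z\<close> with \<open>T(conj x z) \<noteq> 0\<close> shows that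
  \<open>y\<close> is a multiple of \<open>x (z y)\<close>.
\<close>

lemma range_oct_mult_eq_kernel:
  fixes x :: "'a :: {field, finite} octonion"
  assumes "x \<noteq> 0" "oct_perp x x"
  shows "range ((\<star>) x) = {y. x \<star> y = 0}"
proof (intro equalityI subsetI)
  interpret mult: Vector_Spaces.linear oct_scale oct_scale "(\<star>) x"
    by (rule linear_oct_mult)
  fix y assume y: "y \<in> {y. x \<star> y = 0}"
  obtain z where z: "oct_trace (oct_conj x \<star> z) \<noteq> 0"
    using ex_oct_trace_mult_nonzero[of "oct_conj x"] assms
    by (auto simp: oct_perp_def oct_conj_eq_uminus)
  define t where "t = oct_trace (oct_conj x \<star> z)"
  have "oct_scale t y = oct_conj x \<star> (z \<star> y)"
    using oct_conj_mult_polar[of x z y] y by (simp add: t_def)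
  also have "\<dots> = x \<star> (- (z \<star> y))"
    using assms(2) by (simp add: oct_perp_def oct_conj_eq_uminus oct_mult_uminus)
  finally have "x \<star> oct_scale (inverse t) (- (z \<star> y)) = oct_scale (inverse t) (oct_scale t y)"
    by (simp only: mult.scale)
  also have "\<dots> = y"
    using z by (simp add: t_def)
  finally show "y \<in> range ((\<star>) x)"
    by (metis rangeI)
qed (use assms in \<open>auto simp: oct_perp_def oct_left_alternative\<close>)

lemma isotropic_geometry_oct_perp:
  "isotropic_geometry (oct_scale :: 'a :: {field, finite} \<Rightarrow> _) oct_perp"
proof -
  interpret finite_vector_space "oct_scale :: 'a \<Rightarrow> _"
    by (rule finite_vector_space_oct_scale)
  interpret trace: Vector_Spaces.linear oct_scale "(*)" "oct_trace :: 'a octonion \<Rightarrow> 'a"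
    by (rule linear_oct_trace)
  have perp_eq: "{y. oct_perp x y} = {y \<in> {y. x \<star> y = 0}. oct_trace y = 0}" if "oct_perp x x"
    for x :: "'a octonion"
    using that by (auto simp: oct_perp_def)
  have kernel: "subspace {y. x \<star> y = 0}" for x :: "'a octonion"
  proof -
    interpret mult: Vector_Spaces.linear oct_scale oct_scale "(\<star>) x"
      by (rule linear_oct_mult)
    show ?thesis
      by (rule mult.subspace_kernel)
  qed
  show ?thesis
  proof (intro isotropic_geometry.intro isotropic_geometry_axioms.intro finite_vector_space_axioms)
    show "subspace {y. oct_perp x y}" if "oct_perp x x" for x :: "'a octonion"
      using subspace_inter[OF kernel[of x] trace.subspace_kernel]
      by (simp add: perp_eq[OF that] Int_def)
    show "dim {y. oct_perp x y} = 3" if x: "x \<noteq> 0" "oct_perp x x" for x :: "'a octonion"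
    proof -
      have "dim (UNIV :: 'a octonion set) = 8"
        by (intro dim_eq_if_card) (auto simp: eval_nat_numeral)
      hence "dim {y. x \<star> y = 0} = 4"
        using rank_nullity[OF linear_oct_mult[of x]]
        by (simp add: range_oct_mult_eq_kernel[OF x] del: dim_UNIV)
      moreover obtain z where "oct_trace (x \<star> z) \<noteq> 0"
        using ex_oct_trace_mult_nonzero[OF x(1)] by blast
      moreover have "x \<star> z \<in> {y. x \<star> y = 0}"
        using range_oct_mult_eq_kernel[OF x] by blast
      ultimately show ?thesis
        using dim_kernel_functional[OF linear_oct_trace kernel] by (simp add: perp_eq[OF x(2)])
    qed
  qed (auto simp: oct_perp_def[of 0] intro: oct_perp_sym oct_perp_null)
qed

lemma card_oct_perp_self: "card {x :: 'a :: {field, finite} octonion. oct_perp x x} = CARD('a) ^ 6"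
proof -
  define S where "S = {(v\<^sub>1, w\<^sub>1, v\<^sub>2, w\<^sub>2, v\<^sub>3, w\<^sub>3, a :: 'a).
    v\<^sub>1 * w\<^sub>1 + (v\<^sub>2 * w\<^sub>2 + (v\<^sub>3 * w\<^sub>3 + a * a)) = 0}"
  define f :: "_ \<Rightarrow> 'a octonion" where
    "f = (\<lambda>(v\<^sub>1, w\<^sub>1, v\<^sub>2, w\<^sub>2, v\<^sub>3, w\<^sub>3, a). (a, (v\<^sub>1, v\<^sub>2, v\<^sub>3), (w\<^sub>1, w\<^sub>2, w\<^sub>3), - a))"
  have "card S = CARD('a) ^ 6"
    unfolding S_def by (rule card_quadric_zeros)
  moreover have "{x. oct_perp x x} = f ` S"
  proof -
    have "oct_perp (f u) (f u) \<longleftrightarrow> u \<in> S" for u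
    proof -
      have "oct_trace (f u) = 0"
        by (auto simp: f_def octonion_defs split: prod.split)
      moreover have "oct_norm (f u) = - (case u of (v\<^sub>1, w\<^sub>1, v\<^sub>2, w\<^sub>2, v\<^sub>3, w\<^sub>3, a) \<Rightarrow>
          v\<^sub>1 * w\<^sub>1 + (v\<^sub>2 * w\<^sub>2 + (v\<^sub>3 * w\<^sub>3 + a * a)))"
        by (auto simp: f_def octonion_defs algebra_simps split: prod.split)
      ultimately show ?thesis
        by (auto simp: oct_perp_self_iff S_def)
    qed
    moreover have "x \<in> range f" if "oct_trace x = 0" for x
    proof -
      obtain a v\<^sub>1 v\<^sub>2 v\<^sub>3 w\<^sub>1 w\<^sub>2 w\<^sub>3 b where x: "x = (a, (v\<^sub>1, v\<^sub>2, v\<^sub>3), (w\<^sub>1, w\<^sub>2, w\<^sub>3), b)"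
        by (metis prod.exhaust)
      have "b = - a"
        using that by (simp add: x oct_trace_def add_eq_0_iff)
      thus ?thesis
        by (intro range_eqI[of _ _ "(v\<^sub>1, w\<^sub>1, v\<^sub>2, w\<^sub>2, v\<^sub>3, w\<^sub>3, a)"]) (simp add: x f_def)
    qed
    moreover have "oct_trace x = 0" if "oct_perp x x" for x :: "'a octonion"
      using that by (simp add: oct_perp_def)
    ultimately show ?thesis
      by blast
  qed
  moreover have "inj f"
    by (auto simp: inj_def f_def)
  ultimately show ?thesis
    by (simp add: card_image inj_on_subset)
qed

lemma ex_bigraph_split_Cayley_hexagon:
  "ex_bigraph (CARD('a :: {field, finite}) + 1) (2 * (CARD('a) + 1)) 6 (3 * (\<Sum>i<6. CARD('a) ^ i))"
proof -
  interpret isotropic_geometry "oct_scale :: 'a \<Rightarrow> _" oct_perp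
    by (rule isotropic_geometry_oct_perp)
  have near: "\<exists>w\<in>l. (x, w) \<in> perp_graph ^^ Suc 1"
    if x: "x \<noteq> 0" "oct_perp x x" and l: "l \<in> lines" for x l
  proof -
    have "dim l \<ge> 2"
      using lineD(2)[OF l] by simp
    from ex_nonzero_in_kernel_functional[OF linear_oct_trace_mult lineD(1)[OF l] this]
    obtain w where w: "oct_trace (x \<star> w) = 0" "w \<in> l" "w \<noteq> 0" .
    have null: "oct_perp w w"
      using lineD(3)[OF l w(2,2)] .
    have "(x, w) \<in> perp_graph ^^ Suc 1"
      unfolding perp_graph_relpow_2_iff
      using x w(3) ex_oct_perp_between[OF x null w(1)] by (intro conjI)
    thus ?thesis
      using w(2) by (rule bexI)
  qed
  define x y :: "'a octonion" where "x = (0, (1, 0, 0), 0, 0)" and "y = (0, 0, (1, 0, 0), 0)"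
  have xy: "x \<noteq> 0" "oct_perp x x" "y \<noteq> 0" "oct_perp y y"
    by (simp_all add: x_def y_def oct_perp_def octonion_defs zero_prod_def)
  have "z = 0" if "oct_perp x z" "oct_perp z y" for z
  proof -
    obtain a v\<^sub>1 v\<^sub>2 v\<^sub>3 w\<^sub>1 w\<^sub>2 w\<^sub>3 b where z: "z = (a, (v\<^sub>1, v\<^sub>2, v\<^sub>3), (w\<^sub>1, w\<^sub>2, w\<^sub>3), b)"
      by (metis prod.exhaust)
    show ?thesis
      using that by (simp add: z x_def y_def oct_perp_def octonion_defs zero_prod_def)
  qed
  hence "(x, y) \<notin> perp_graph ^^ Suc 1"
    unfolding perp_graph_relpow_2_iff by blast
  from has_diameter_even[OF near xy this] show ?thesis
    by (intro ex_bigraph_if_has_diameter) (simp_all add: card_oct_perp_self)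
qed

section \<open>Finite fields\<close>

lemma order_le_1_if_pderiv_nonzero:
  assumes "poly (pderiv p) x \<noteq> 0"
  shows "order x p \<le> 1"
proof (rule ccontr)
  assume "\<not> order x p \<le> 1"
  hence "[:-x, 1:] ^ 2 dvd p"
    by (simp add: order_divides)
  then obtain q where "p = [:-x, 1:] ^ 2 * q"
    by (elim dvdE)
  hence "p = [:-x, 1:] * ([:-x, 1:] * q)"
    by (simp only: power2_eq_square mult.assoc)
  hence "poly (pderiv p) x = 0"
    by (simp only: pderiv_mult poly_add poly_mult) simp
  thus False
    using assms by contradiction
qed

lemma size_proots_alg_closed: "size (proots p) = degree p" for p :: "'a :: alg_closed_field poly"
proof (cases "p = 0")
  case False
  then obtain A where A: "size A = degree p" "p = smult (lead_coeff p) (\<Prod>x\<in>#A. [:-x, 1:])"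
    using alg_closed_imp_factorization by blast
  have "proots (\<Prod>x\<in>#A. [:-x, 1:]) = A"
  proof -
    have "0 \<notin># {#[:-x, 1:]. x \<in># A#}"
      by auto
    from proots_prod_mset[OF this] show ?thesis
      by (simp add: image_mset.compositionality o_def)
  qed
  moreover have "lead_coeff p \<noteq> 0"
    using False by simp
  ultimately have "proots p = A"
    by (subst A(2)) simp
  thus ?thesis
    using A(1) by simp
qed simp

lemma card_poly_roots_alg_closed:
  fixes p :: "'a :: alg_closed_field poly"
  assumes "\<And>x. poly p x = 0 \<Longrightarrow> poly (pderiv p) x \<noteq> 0"
  shows "card {x. poly p x = 0} = degree p"
proof -
  have "p \<noteq> 0"
    using assms[of 0] by auto
  have "count (proots p) x = 1" if "x \<in># proots p" for x
    using that order_le_1_if_pderiv_nonzero[OF assms, of x] \<open>p \<noteq> 0\<close>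
    by (simp add: order_root le_Suc_eq)
  hence "size (proots p) = card (set_mset (proots p))"
    by (simp add: size_multiset_overloaded_eq)
  thus ?thesis
    using \<open>p \<noteq> 0\<close> by (simp add: size_proots_alg_closed)
qed

lemma card_frobenius_fixed_points:
  assumes prime: "prime CHAR('a :: alg_closed_field)" and q: "q = CHAR('a) ^ n" "n > 0"
  shows "card {x :: 'a. x ^ q = x} = q"
proof -
  define f :: "'a poly" where "f = monom 1 q - monom 1 1"
  have "q > 1"
    unfolding q using prime q(2) by (intro one_less_power prime_gt_1_nat)
  have "of_nat q = (0 :: 'a)"
    using q by simp
  hence "pderiv f = -1"
    by (simp add: f_def pderiv_diff pderiv_monom monom_0 one_pCons)
  hence "card {x. poly f x = 0} = degree f"
    by (intro card_poly_roots_alg_closed) simp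
  also have "degree f = q"
    unfolding f_def diff_conv_add_uminus
    by (subst degree_add_eq_left) (use \<open>q > 1\<close> in \<open>auto simp: degree_monom_eq\<close>)
  finally show ?thesis
    by (simp add: f_def poly_monom)
qed

lemma frobenius_add: "(x + y) ^ (CARD('p) ^ n) = x ^ (CARD('p) ^ n) + y ^ (CARD('p) ^ n)"
  for x y :: "'p :: prime_card mod_ring alg_closure"
  by (rule freshmans_dream') (simp_all add: prime_card)

lemma frobenius_minus: "(- x) ^ (CARD('p) ^ n) = - (x ^ (CARD('p) ^ n))"
  for x :: "'p :: prime_card mod_ring alg_closure"
  using frobenius_add[of x "- x" n] by (simp add: eq_neg_iff_add_eq_0 add.commute power_0_left)

text \<open>The type parameter \<open>'n\<close> only supplies the exponent of the order \<open>CARD('p) ^ CARD('n)\<close>.\<close>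

typedef (overloaded) ('p, 'n) galois_field =
  "{x :: 'p :: prime_card mod_ring alg_closure. x ^ (CARD('p) ^ CARD('n :: finite)) = x}"
  using power_one by blast

lemma CARD_galois_field: "CARD(('p :: prime_card, 'n :: finite) galois_field) = CARD('p) ^ CARD('n)"
proof -
  have "card {x :: 'p mod_ring alg_closure. x ^ (CARD('p) ^ CARD('n)) = x} = CARD('p) ^ CARD('n)"
    by (rule card_frobenius_fixed_points[where n = "CARD('n)"]) (simp_all add: prime_card)
  thus ?thesis
    by (simp add: type_definition.card[OF type_definition_galois_field])
qed

setup_lifting type_definition_galois_field

instantiation galois_field :: (prime_card, finite) field
begin

lift_definition zero_galois_field :: "('a, 'b) galois_field" is 0
  by (simp add: power_0_left)

lift_definition one_galois_field :: "('a, 'b) galois_field" is 1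
  by simp

lift_definition plus_galois_field ::
  "('a, 'b) galois_field \<Rightarrow> ('a, 'b) galois_field \<Rightarrow> ('a, 'b) galois_field" is "(+)"
  by (simp add: frobenius_add)

lift_definition uminus_galois_field :: "('a, 'b) galois_field \<Rightarrow> ('a, 'b) galois_field" is uminus
  by (simp add: frobenius_minus)

lift_definition minus_galois_field ::
  "('a, 'b) galois_field \<Rightarrow> ('a, 'b) galois_field \<Rightarrow> ('a, 'b) galois_field" is "(-)"
  by (simp add: frobenius_add frobenius_minus diff_conv_add_uminus del: add_uminus_conv_diff)

lift_definition times_galois_field ::
  "('a, 'b) galois_field \<Rightarrow> ('a, 'b) galois_field \<Rightarrow> ('a, 'b) galois_field" is "(*)"
  by (simp add: power_mult_distrib)

lift_definition inverse_galois_field :: "('a, 'b) galois_field \<Rightarrow> ('a, 'b) galois_field" is inverse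
  by (simp add: power_inverse)

lift_definition divide_galois_field ::
  "('a, 'b) galois_field \<Rightarrow> ('a, 'b) galois_field \<Rightarrow> ('a, 'b) galois_field" is "(/)"
  by (simp add: power_divide)

instance
  by standard (transfer; simp add: field_simps)+

end

instance galois_field :: (prime_card, finite) finite
  by standard (rule card_ge_0_finite, simp add: CARD_galois_field)

section \<open>Bigraphs for all prime powers\<close>

definition has_polygon_bigraphs :: "nat \<Rightarrow> bool" where
  "has_polygon_bigraphs q \<longleftrightarrow>
     (\<forall>d\<in>{3, 4, 6}. ex_bigraph (q + 1) (2 * (q + 1)) d (3 * (\<Sum>i<d. q ^ i)))"

lemma has_polygon_bigraphs_CARD: "has_polygon_bigraphs CARD('a :: {field, finite})"
  unfolding has_polygon_bigraphs_def
  using projective_plane.ex_bigraph_projective_plane[OF projective_plane_scale3[where ?'a = 'a]]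
    symplectic_space.ex_bigraph_symplectic_quadrangle
      [OF symplectic_space_symplectic_form[where ?'a = 'a]]
    ex_bigraph_split_Cayley_hexagon[where ?'a = 'a] by simp

text \<open>
  A type cannot depend on the variable \<open>q\<close>. The closed term \<open>exceptional_order\<close> is a prime power
  without the required bigraphs if there is one, so that a single field type of this order suffices.
\<close>

definition exceptional_order :: nat where
  "exceptional_order = (SOME q. primepow q \<and>
     (has_polygon_bigraphs q \<longrightarrow> (\<forall>q'. primepow q' \<longrightarrow> has_polygon_bigraphs q')))"

lemma
  shows primepow_exceptional_order: "primepow exceptional_order"
    and has_polygon_bigraphs_if_exceptional_order:
      "has_polygon_bigraphs exceptional_order \<Longrightarrow> primepow q \<Longrightarrow> has_polygon_bigraphs q"
proof -
  have "\<exists>q. primepow q \<and> (has_polygon_bigraphs q \<longrightarrow> (\<forall>q'. primepow q' \<longrightarrow> has_polygon_bigraphs q'))"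
    using primepow_prime[OF two_is_prime_nat] by metis
  from someI_ex[OF this] show "primepow exceptional_order"
    "has_polygon_bigraphs exceptional_order \<Longrightarrow> primepow q \<Longrightarrow> has_polygon_bigraphs q"
    unfolding exceptional_order_def by blast+
qed

definition exceptional_exponent :: nat where
  "exceptional_exponent = multiplicity (aprimedivisor exceptional_order) exceptional_order"

lemma prime_aprimedivisor_exceptional_order: "prime (aprimedivisor exceptional_order)"
  using primepow_gt_Suc_0[OF primepow_exceptional_order] by (intro aprimedivisor_nat) simp

lemma exceptional_exponent_pos: "exceptional_exponent > 0"
  by (simp add: exceptional_exponent_def primepow_gt_Suc_0[OF primepow_exceptional_order])

typedef exceptional_prime = "{..<aprimedivisor exceptional_order}"
  using prime_gt_0_nat[OF prime_aprimedivisor_exceptional_order] by blast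

lemma CARD_exceptional_prime: "CARD(exceptional_prime) = aprimedivisor exceptional_order"
  using type_definition.card[OF type_definition_exceptional_prime] by simp

instance exceptional_prime :: prime_card
  by standard (simp add: CARD_exceptional_prime prime_aprimedivisor_exceptional_order)

typedef exceptional_degree = "{..<exceptional_exponent}"
  using exceptional_exponent_pos by blast

lemma CARD_exceptional_degree: "CARD(exceptional_degree) = exceptional_exponent"
  using type_definition.card[OF type_definition_exceptional_degree] by simp

instance exceptional_degree :: finite
  by standard (rule card_ge_0_finite, simp add: CARD_exceptional_degree exceptional_exponent_pos)

lemma has_polygon_bigraphs_if_primepow:
  assumes "primepow q"
  shows "has_polygon_bigraphs q"
proof -
  have "CARD((exceptional_prime, exceptional_degree) galois_field) = exceptional_order"
    by (simp add: CARD_galois_field CARD_exceptional_prime CARD_exceptional_degree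
      exceptional_exponent_def primepow_decompose primepow_exceptional_order)
  hence "has_polygon_bigraphs exceptional_order"
    by (metis has_polygon_bigraphs_CARD)
  thus ?thesis
    using assms by (rule has_polygon_bigraphs_if_exceptional_order)
qed

section \<open>Orders and defects\<close>

lemma moore_bound_3:
  "moore_bound r 3 = 3 / 2 * (real r * (2 * real r - 1) + (if odd r then 1 else 0))"
proof (cases "odd r")
  case True
  then obtain k where k: "r = 2 * k + 1"
    by (elim oddE)
  have "\<lfloor>(1 + real r * (2 * real r - 1)) / 2\<rfloor> = 4 * int k ^ 2 + 3 * int k + 1"
    by (rule floor_unique) (simp_all add: k field_simps power2_eq_square)
  hence "moore_bound r 3 = 3 * real_of_int (4 * int k ^ 2 + 3 * int k + 1)"
    by (simp add: moore_bound_def)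
  thus ?thesis
    by (simp add: k field_simps power2_eq_square)
next
  case False
  then obtain k where k: "r = 2 * k"
    by (auto elim: evenE)
  have "\<lfloor>(1 + real r * (2 * real r - 1)) / 2\<rfloor> = 4 * int k ^ 2 - int k"
    by (rule floor_unique) (simp_all add: k field_simps power2_eq_square)
  hence "moore_bound r 3 = 3 * real_of_int (4 * int k ^ 2 - int k)"
    by (simp add: moore_bound_def)
  thus ?thesis
    by (simp add: k field_simps power2_eq_square)
qed

lemma moore_bound_even:
  assumes "r \<ge> 2"
  shows "moore_bound r (2 * m) = 3 * real r * (\<Sum>i<m. ((2 * real r - 1) * (real r - 1)) ^ i)"
proof -
  have "3 * 1 \<le> (2 * real r - 1) * (real r - 1)"
    using assms by (intro mult_mono) auto
  moreover have "2 * m \<noteq> 3"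
    by presburger
  ultimately show ?thesis
    by (simp add: moore_bound_def geometric_sum)
qed

lemma order_defect_3:
  assumes "q + 1 = r" "card (verts G) = 3 * (\<Sum>i<3. q ^ i)"
  shows "real (card (verts G)) = 3 * real r ^ 2 - 3 * real r + 3"
    and "defect r 3 G = (if odd r then 3 / 2 * (real r - 1) else 3 * real r / 2 - 3)"
proof -
  show order: "real (card (verts G)) = 3 * real r ^ 2 - 3 * real r + 3"
    unfolding assms by (simp flip: assms(1) add: eval_nat_numeral algebra_simps)
  show "defect r 3 G = (if odd r then 3 / 2 * (real r - 1) else 3 * real r / 2 - 3)"
    unfolding defect_def order moore_bound_3 by (simp add: field_simps power2_eq_square)
qed

lemma order_defect_4:
  assumes "q + 1 = r" "q > 0" "card (verts G) = 3 * (\<Sum>i<4. q ^ i)"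
  shows "real (card (verts G)) = 3 * real r ^ 3 - 6 * real r ^ 2 + 6 * real r"
    and "defect r 4 G = 3 * real r ^ 3 - 3 * real r ^ 2"
proof -
  show order: "real (card (verts G)) = 3 * real r ^ 3 - 6 * real r ^ 2 + 6 * real r"
    unfolding assms by (simp flip: assms(1) add: eval_nat_numeral algebra_simps)
  have "moore_bound r 4 = 3 * real r * (\<Sum>i<2. ((2 * real r - 1) * (real r - 1)) ^ i)"
    using moore_bound_even[of r 2] assms by simp
  thus "defect r 4 G = 3 * real r ^ 3 - 3 * real r ^ 2"
    unfolding defect_def order by (simp add: eval_nat_numeral algebra_simps)
qed

lemma order_defect_6:
  assumes "q + 1 = r" "q > 0" "card (verts G) = 3 * (\<Sum>i<6. q ^ i)"
  shows "real (card (verts G)) =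
      3 * real r ^ 5 - 12 * real r ^ 4 + 21 * real r ^ 3 - 18 * real r ^ 2 + 9 * real r"
    and "defect r 6 G = 9 * real r ^ 5 - 24 * real r ^ 4 + 24 * real r ^ 3 - 9 * real r ^ 2"
proof -
  show order: "real (card (verts G)) =
      3 * real r ^ 5 - 12 * real r ^ 4 + 21 * real r ^ 3 - 18 * real r ^ 2 + 9 * real r"
    unfolding assms by (simp flip: assms(1) add: eval_nat_numeral algebra_simps)
  have "moore_bound r 6 = 3 * real r * (\<Sum>i<3. ((2 * real r - 1) * (real r - 1)) ^ i)"
    using moore_bound_even[of r 3] assms by simp
  thus "defect r 6 G = 9 * real r ^ 5 - 24 * real r ^ 4 + 24 * real r ^ 3 - 9 * real r ^ 2"
    unfolding defect_def order by (simp add: eval_nat_numeral algebra_simps)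
qed

theorem theorem4p5:
  fixes r :: nat
  assumes "r \<ge> 3" and "primepow (r - 1)"
  shows
    "(\<exists>G :: (nat, nat \<times> nat) pre_digraph. bigraph r (2 * r) 3 G \<and>
        real (card (verts G)) = 3 * real r ^ 2 - 3 * real r + 3 \<and>
        (odd r \<longrightarrow> defect r 3 G = 3 / 2 * (real r - 1)) \<and>
        (even r \<longrightarrow> defect r 3 G = 3 * real r / 2 - 3)) \<and>
     (\<exists>G :: (nat, nat \<times> nat) pre_digraph. bigraph r (2 * r) 4 G \<and>
        real (card (verts G)) = 3 * real r ^ 3 - 6 * real r ^ 2 + 6 * real r \<and>
        defect r 4 G = 3 * real r ^ 3 - 3 * real r ^ 2) \<and>
     (\<exists>G :: (nat, nat \<times> nat) pre_digraph. bigraph r (2 * r) 6 G \<and>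
        real (card (verts G)) =
          3 * real r ^ 5 - 12 * real r ^ 4 + 21 * real r ^ 3 - 18 * real r ^ 2 + 9 * real r \<and>
        defect r 6 G =
          9 * real r ^ 5 - 24 * real r ^ 4 + 24 * real r ^ 3 - 9 * real r ^ 2)"
proof -
  define q where "q = r - 1"
  have q: "q + 1 = r" "q > 0"
    using assms(1) by (simp_all add: q_def)
  have "has_polygon_bigraphs q"
    using assms(2) unfolding q_def by (rule has_polygon_bigraphs_if_primepow)
  hence "ex_bigraph r (2 * r) 3 (3 * (\<Sum>i<3. q ^ i))" "ex_bigraph r (2 * r) 4 (3 * (\<Sum>i<4. q ^ i))"
    "ex_bigraph r (2 * r) 6 (3 * (\<Sum>i<6. q ^ i))"
    unfolding has_polygon_bigraphs_def q(1) by blast+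
  then obtain G\<^sub>3 G\<^sub>4 G\<^sub>6 :: "(nat, nat \<times> nat) pre_digraph" where
    G: "bigraph r (2 * r) 3 G\<^sub>3" "card (verts G\<^sub>3) = 3 * (\<Sum>i<3. q ^ i)"
      "bigraph r (2 * r) 4 G\<^sub>4" "card (verts G\<^sub>4) = 3 * (\<Sum>i<4. q ^ i)"
      "bigraph r (2 * r) 6 G\<^sub>6" "card (verts G\<^sub>6) = 3 * (\<Sum>i<6. q ^ i)"
    unfolding ex_bigraph_def by blast
  show ?thesis
    using G(1,3,5) order_defect_3[OF q(1) G(2)] order_defect_4[OF q G(4)] order_defect_6[OF q G(6)]
    by (intro conjI exI[of _ G\<^sub>3] exI[of _ G\<^sub>4] exI[of _ G\<^sub>6]) simp_all
qed

end
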